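(* Let $\rho(t,\cdot)$ be a solution of the kinetic Kuramoto equation for identical oscillators with initial datum $\rho_0$ (a Borel probability measure on $\mathcal T$) which is not a stationary solution. Then $\rho(t,\cdot)$ converges weakly-* as $t\to\infty$ to a stationary solution $\rho^*$ of type $(c_1,c_2)$. Moreover, if $\rho_0$ is non-atomic (gives zero measure to every point), then $\rho^*=\delta_{\varphi^*}$, where $\varphi^*=\lim_{t\to\infty}\varphi(t)$ (complete phase synchronization).
   Context: Kinetic Kuramoto equation for identical oscillators: characteristics $\dot\Theta(t,\vartheta)=-R(t)\sin(\Theta(t,\vartheta)-\varphi(t))$, $\Theta(0,\vartheta)=\vartheta$, with $R(t)e^{\mathrm{i}\varphi(t)}=\int_{\mathcal T}e^{\mathrm{i}\vartheta}\,d\rho(t,\vartheta)$, and $\rho(t,\cdot)$ the push-forward of $\rho_0$ on $\mathcal T=\mathbb R/2\pi\mathbb Z$ under $\Theta(t,\cdot)$. A stationary solution is one constant in time. A measure is of type $(c_1,c_2)$ if it equals $c_1\delta_{\varphi^*}+c_2\delta_{\varphi^*+\pi}$ with $c_1>c_2\ge 0$, $c_1+c_2=1$. *)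

theory Defs
  imports "HOL-Probability.Probability"
begin

text \<open>The torus T = R/2piZ is modelled by its lift R: a Borel probability measure on T is a
  Borel probability measure on R concentrated on the fundamental domain [0,2pi); functions on T
  are 2pi-periodic functions on R.\<close>

definition circ_cont :: "(real \<Rightarrow> real) \<Rightarrow> bool" where
  "circ_cont f \<longleftrightarrow> continuous_on UNIV f \<and> (\<forall>x. f (x + 2 * pi) = f x)"

text \<open>Characteristics of the kinetic Kuramoto equation for identical oscillators with
  initial datum rho0; rho(t) is the push-forward of rho0 under Theta t, so that integrals
  against rho(t) are integrals of the composition against rho0.\<close>

definition kuramoto_solution ::
  "real measure \<Rightarrow> (real \<Rightarrow> real \<Rightarrow> real) \<Rightarrow> (real \<Rightarrow> real) \<Rightarrow> (real \<Rightarrow> real) \<Rightarrow> bool" where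
  "kuramoto_solution \<rho>0 \<Theta> R \<phi> \<longleftrightarrow>
     (\<forall>\<theta>. \<Theta> 0 \<theta> = \<theta>) \<and>
     (\<forall>\<theta> t. t \<ge> 0 \<longrightarrow>
        ((\<lambda>s. \<Theta> s \<theta>) has_real_derivative (- R t * sin (\<Theta> t \<theta> - \<phi> t))) (at t within {0..})) \<and>
     (\<forall>t \<ge> 0. \<Theta> t \<in> borel_measurable borel \<and> R t \<ge> 0 \<and>
        complex_of_real (R t) * cis (\<phi> t) = (\<integral>\<theta>. cis (\<Theta> t \<theta>) \<partial>\<rho>0))"

text \<open>The solution is stationary iff rho(t) = rho0 (as measures on T) for all t >= 0,
  tested against continuous functions on T.\<close>

definition kuramoto_stationary :: "real measure \<Rightarrow> (real \<Rightarrow> real \<Rightarrow> real) \<Rightarrow> bool" where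
  "kuramoto_stationary \<rho>0 \<Theta> \<longleftrightarrow>
     (\<forall>t \<ge> 0. \<forall>f. circ_cont f \<longrightarrow> (\<integral>\<theta>. f (\<Theta> t \<theta>) \<partial>\<rho>0) = (\<integral>\<theta>. f \<theta> \<partial>\<rho>0))"

definition weak_star_conv_type ::
  "real measure \<Rightarrow> (real \<Rightarrow> real \<Rightarrow> real) \<Rightarrow> real \<Rightarrow> real \<Rightarrow> real \<Rightarrow> bool" where
  "weak_star_conv_type \<rho>0 \<Theta> c1 c2 \<phi>s \<longleftrightarrow>
     (\<forall>f. circ_cont f \<longrightarrow>
        ((\<lambda>t. \<integral>\<theta>. f (\<Theta> t \<theta>) \<partial>\<rho>0) \<longlongrightarrow> c1 * f \<phi>s + c2 * f (\<phi>s + pi)) at_top)"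

end

theory Submission
  imports Defs
begin

text \<open>Write \<open>co\<close> and \<open>si\<close> for the cosine and sine of \<open>\<Theta> - \<phi>\<close>, let \<open>S\<close> be the mean of \<open>si\<^sup>2\<close>, and let
  \<open>q = \<phi>'\<close>. Then \<open>R' = R S\<close>, so a non-stationary solution has \<open>R\<close> increasing to a positive limit, and
  \<open>S\<close>, \<open>q\<close> tend to \<open>0\<close> by Barbalat. Hence along every characteristic \<open>co\<close> tends to \<open>1\<close> or \<open>-1\<close>, and since
  the antipode repels, at most one point \<open>p\<close> of the circle has \<open>co \<rightarrow> -1\<close>; its mass is \<open>c2\<close>, and the
  limit \<open>1 - 2 c2\<close> of \<open>R\<close> is positive. It remains that \<open>\<phi>\<close> converges. As the mean of \<open>si\<close> is \<open>0\<close>, \<open>q\<close>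
  is the mean of \<open>si (1 - co)\<close>, which splits into a term \<open>E\<close> from the points other than \<open>p\<close> and a
  term of size at most \<open>2 c2 |si p|\<close>. The derivative of the mean \<open>U\<close> of \<open>2 \<surd>(1 + co)\<close> over the
  points other than \<open>p\<close> dominates \<open>E\<close> up to a vanishing multiple of \<open>|q|\<close>, while \<open>c2 |si p|\<close> grows at a rate
  at least \<open>3/4 c2 |si p| - E\<close>. A combination of these two bounded functions therefore grows at
  least as fast as \<open>|q|\<close>, so \<open>\<phi>\<close> has bounded variation. No angular lift of \<open>\<phi>\<close> is needed: the
  argument is applied to \<open>cos \<phi>\<close> and \<open>sin \<phi>\<close>.\<close>

section \<open>Calculus on half-lines\<close>

text \<open>Derivatives are taken within a half-line because the flow equation is given in that form
  at time 0. Keeping \<open>T\<close> apart from \<open>a\<close> allows a sign that holds only for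
  late times.\<close>

lemma mono_of_deriv_nonneg_halfline:
  fixes f :: "real \<Rightarrow> real"
  assumes der: "\<And>t. a \<le> t \<Longrightarrow> (f has_real_derivative f' t) (at t within {a..})"
    and nn: "\<And>t. T \<le> t \<Longrightarrow> 0 \<le> f' t" and "a \<le> T" "T \<le> x" "x \<le> y"
  shows "f x \<le> f y"
proof (rule DERIV_nonneg_imp_increasing_open[OF \<open>x \<le> y\<close>])
  fix t assume t: "x < t" "t < y"
  have "at t within {a..} = at t"
    using t \<open>a \<le> T\<close> \<open>T \<le> x\<close> by (intro at_within_interior) auto
  then show "\<exists>y. DERIV f t :> y \<and> 0 \<le> y"
    using der[of t] nn[of t] t \<open>a \<le> T\<close> \<open>T \<le> x\<close> by (intro exI[of _ "f' t"]) simp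
next
  have "continuous_on {a..} f"
    by (rule DERIV_continuous_on, rule der) simp
  then show "continuous_on {x..y} f"
    by (rule continuous_on_subset) (use \<open>a \<le> T\<close> \<open>T \<le> x\<close> in auto)
qed

text \<open>\<open>f\<close> is nondecreasing and bounded, so its late increments are arbitrarily
  small. As \<open>g\<close> changes at rate at most \<open>K\<close>, a late value
  \<open>g t >= e\<close> would keep \<open>g\<close> above \<open>e / 2\<close> on a window of
  fixed length and force too large an increment.\<close>

lemma barbalat:
  fixes f g g' :: "real \<Rightarrow> real"
  assumes f: "\<And>t. a \<le> t \<Longrightarrow> (f has_real_derivative g t) (at t within {a..})"
    and g: "\<And>t. a \<le> t \<Longrightarrow> (g has_real_derivative g' t) (at t within {a..})"
    and nn: "\<And>t. a \<le> t \<Longrightarrow> 0 \<le> g t"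
    and K: "\<And>t. a \<le> t \<Longrightarrow> \<bar>g' t\<bar> \<le> K"
    and B: "\<And>t. a \<le> t \<Longrightarrow> f t \<le> B"
  shows "(g \<longlongrightarrow> 0) at_top"
proof -
  have Kpos: "0 \<le> K" using K[of a] by force
  have K_lower: "0 \<le> g' t + K" if "a \<le> t" for t using K[OF that] by linarith
  have mono: "f x \<le> f y" if "a \<le> x" "x \<le> y" for x y
    using that nn by (intro mono_of_deriv_nonneg_halfline[OF f, where T=a and x=x and y=y]) simp_all
  have "\<exists>T\<ge>a. \<forall>t\<ge>T. g t < e" if e: "0 < e" for e
  proof -
    define h where "h = e / (2 * (K + 1))"
    \<comment> \<open>On a window of length \<open>h\<close> the function \<open>g\<close> drops by
      at most \<open>e / 2\<close>; the \<open>+ 1\<close> in \<open>h\<close> covers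
      \<open>K = 0\<close>. The number \<open>d\<close> below is the increment of \<open>f\<close>
      that such a window would force.\<close>
    have h: "0 < h" "K * h \<le> e / 2"
      using e Kpos by (auto simp: h_def field_simps)
    define d where "d = e / 2 * h"
    have d: "0 < d" using e h by (simp add: d_def)
    define l where "l = (SUP t\<in>{a..}. f t)"
    have bdd: "bdd_above (f ` {a..})" using B by (auto simp: bdd_above_def)
    have "l - d < l" using d by simp
    then obtain T where T: "a \<le> T" "l - d < f T"
      unfolding l_def using less_cSUP_iff[OF _ bdd] by auto
    have "g t < e" if t: "T \<le> t" for t
    proof (rule ccontr)
      assume "\<not> g t < e"
      have gge: "e / 2 \<le> g x" if x: "t \<le> x" "x \<le> t + h" for x
      proof -
        have "g t + K * t \<le> g x + K * x"
          by (rule mono_of_deriv_nonneg_halfline[where a=a and T=t and f="\<lambda>t. g t + K * t" and f'="\<lambda>t. g' t + K"])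
            (use T t x K_lower in \<open>auto intro!: derivative_eq_intros g\<close>)
        moreover have "K * (x - t) \<le> K * h" using x Kpos by (intro mult_left_mono) auto
        ultimately show ?thesis using h \<open>\<not> g t < e\<close> by (simp add: algebra_simps)
      qed
      have "f t - e / 2 * t \<le> f (t + h) - e / 2 * (t + h)"
      proof (rule DERIV_nonneg_imp_increasing_open[where f="\<lambda>x. f x - e / 2 * x"])
        fix x assume x: "t < x" "x < t + h"
        have "at x within {a..} = at x"
          using t T x by (intro at_within_interior) auto
        then have "((\<lambda>x. f x - e / 2 * x) has_real_derivative g x - e / 2) (at x)"
          using f[of x] t T x by (auto intro!: derivative_eq_intros)
        then show "\<exists>y. DERIV (\<lambda>x. f x - e / 2 * x) x :> y \<and> 0 \<le> y"
          using gge[of x] x by (intro exI[of _ "g x - e / 2"]) auto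
      next
        have "continuous_on {a..} f"
          by (rule DERIV_continuous_on, rule f) simp
        then have "continuous_on {t..t+h} f"
          by (rule continuous_on_subset) (use t T in auto)
        then show "continuous_on {t..t+h} (\<lambda>x. f x - e / 2 * x)"
          by (intro continuous_intros)
      qed (use h in auto)
      then have "f t + d \<le> f (t + h)" by (simp add: d_def distrib_left)
      moreover have "f T \<le> f t" using mono T t by auto
      moreover have "f (t + h) \<le> l"
        unfolding l_def by (rule cSUP_upper[OF _ bdd]) (use T t h in auto)
      ultimately show False using T by linarith
    qed
    then show ?thesis using T by blast
  qed
  note small = this
  show ?thesis
  proof (rule tendstoI)
    fix e :: real assume "0 < e"
    from small[OF this] obtain T where "T \<ge> a" "\<forall>t\<ge>T. g t < e" by blast
    then show "eventually (\<lambda>t. dist (g t) 0 < e) at_top"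
      unfolding eventually_at_top_linorder using nn by (intro exI[of _ T]) auto
  qed
qed

text \<open>At the last time \<open>u\<close> with \<open>b <= f u\<close> the intermediate value
  theorem gives \<open>f u = b\<close>, and the positive derivative there lifts \<open>f\<close>
  above \<open>b\<close> just after \<open>u\<close>. A sign condition on the level \<open>b\<close>
  alone therefore suffices.\<close>

lemma barrier_halfline:
  fixes f :: "real \<Rightarrow> real"
  assumes der: "\<And>t. a \<le> t \<Longrightarrow> (f has_real_derivative f' t) (at t within {a..})"
    and pos: "\<And>t. a \<le> t \<Longrightarrow> f t = b \<Longrightarrow> 0 < f' t"
    and "b \<le> f a" "a \<le> t"
  shows "b \<le> f t"
proof (rule ccontr)
  assume neg: "\<not> b \<le> f t"
  have cont: "continuous_on {a..t} f"
    by (rule continuous_on_subset[OF DERIV_continuous_on[of "{a..}"]], rule der) auto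
  define A where "A = {x \<in> {a..t}. b \<le> f x}"
  have "A = {a..t} \<inter> f -` {b..}" by (auto simp: A_def)
  then have "closed A" using continuous_closed_preimage[OF cont, of "{b..}"] by simp
  moreover have ne: "A \<noteq> {}" "bdd_above A"
    using \<open>b \<le> f a\<close> \<open>a \<le> t\<close> by (auto simp: A_def)
  ultimately have SupA: "Sup A \<in> A" by (intro closed_contains_Sup)
  define u where "u = Sup A"
  have u: "a \<le> u" "u < t" "b \<le> f u"
    using SupA neg by (auto simp: A_def u_def less_le)
  have after: "f x < b" if "u < x" "x \<le> t" for x
  proof (rule ccontr)
    assume "\<not> f x < b"
    then have "x \<in> A" using that u by (auto simp: A_def)
    then have "x \<le> u" unfolding u_def by (rule cSup_upper[OF _ ne(2)])
    then show False using that by simp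
  qed
  have "f u \<le> b"
  proof (rule ccontr)
    assume "\<not> f u \<le> b"
    have "continuous_on {u..t} f" by (rule continuous_on_subset[OF cont]) (use u in auto)
    then obtain x where "u \<le> x" "x \<le> t" "f x = b"
      using IVT2'[of f t b u] neg u \<open>\<not> f u \<le> b\<close> by auto
    then show False using after[of x] \<open>\<not> f u \<le> b\<close> by (cases "x = u") auto
  qed
  then have "f u = b" using u by simp
  then have "0 < f' u" using pos u by auto
  have "(f has_real_derivative f' u) (at u within {u..})"
    by (rule DERIV_subset[OF der]) (use u in auto)
  from has_real_derivative_pos_inc_right[OF this \<open>0 < f' u\<close>]
  obtain d where d: "d > 0" "\<And>h. 0 < h \<Longrightarrow> u + h \<in> {u..} \<Longrightarrow> h < d \<Longrightarrow> f u < f (u + h)"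
    by auto
  define h where "h = min (d / 2) (t - u)"
  have "0 < h" "h < d" "u + h \<le> t" using d u by (auto simp: h_def)
  then show False using d(2)[of h] after[of "u + h"] \<open>f u = b\<close> by auto
qed

text \<open>If \<open>f\<close> does not tend to -1, it is at distance at least some
  \<open>e\<close> from -1 at arbitrarily late times. From such a time on, the level
  \<open>-1 + k\<close> is a barrier, the drift carries \<open>f\<close> across the band up to
  \<open>1 - k\<close>, and that level is then a barrier too.\<close>

lemma dichotomy_of_drift:
  fixes f :: "real \<Rightarrow> real"
  assumes der: "\<And>t. a \<le> t \<Longrightarrow> (f has_real_derivative f' t) (at t within {a..})"
    and range: "\<And>t. a \<le> t \<Longrightarrow> \<bar>f t\<bar> \<le> 1"
    and drift: "\<And>k. 0 < k \<Longrightarrow> k < 1 \<Longrightarrow>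
      \<exists>d>0. eventually (\<lambda>t. \<bar>f t\<bar> \<le> 1 - k \<longrightarrow> d \<le> f' t) at_top"
  shows "(f \<longlongrightarrow> 1) at_top \<or> (f \<longlongrightarrow> -1) at_top"
proof (cases "(f \<longlongrightarrow> -1) at_top")
  case False
  then obtain e where e: "e > 0" "\<not> eventually (\<lambda>t. dist (f t) (-1) < e) at_top"
    unfolding tendsto_iff by auto
  have "eventually (\<lambda>t. 1 - k \<le> f t) at_top" if k: "0 < k" "k < 1" "k \<le> e" for k
  proof -
    obtain d T where d: "d > 0" and T: "\<And>t. t \<ge> T \<Longrightarrow> \<bar>f t\<bar> \<le> 1 - k \<Longrightarrow> d \<le> f' t"
      using drift[OF k(1,2)] by (auto simp: eventually_at_top_linorder)
    obtain t0 where t0: "t0 \<ge> max a T" "\<not> dist (f t0) (-1) < e"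
      using e(2) unfolding eventually_at_top_linorder by blast
    have ft0: "-1 + k \<le> f t0"
      using t0(2) k range[of t0] t0(1) by (auto simp: dist_real_def)
    have der': "(f has_real_derivative f' t) (at t within {u..})" if "u \<ge> t0" "t \<ge> u" for t u
      by (rule DERIV_subset[OF der]) (use that t0 in auto)
    have lower: "-1 + k \<le> f t" if "t \<ge> t0" for t
    proof (rule barrier_halfline[OF der'[of t0] _ ft0 that])
      fix t assume "t0 \<le> t" "f t = -1 + k"
      then have "d \<le> f' t" using T[of t] k t0 by auto
      then show "0 < f' t" using d by simp
    qed auto
    have "\<exists>t1\<ge>t0. 1 - k \<le> f t1"
    proof (rule ccontr)
      assume "\<not> (\<exists>t1\<ge>t0. 1 - k \<le> f t1)"
      then have *: "\<forall>t\<ge>t0. f t < 1 - k" by force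
      \<comment> \<open>Rising at rate \<open>d\<close> for this long gains 3, more than the length
        2 of the range of \<open>f\<close>.\<close>
      define t1 where "t1 = t0 + 3 / d"
      have t1: "t0 \<le> t1" using d by (simp add: t1_def)
      have "f t0 - d * t0 \<le> f t1 - d * t1"
      proof (rule mono_of_deriv_nonneg_halfline[where a=t0 and T=t0 and f="\<lambda>t. f t - d * t" and f'="\<lambda>t. f' t - d"])
        fix t assume "t0 \<le> t"
        then have "\<bar>f t\<bar> \<le> 1 - k" using lower[of t] *[rule_format, of t] by (simp add: abs_le_iff)
        then show "0 \<le> f' t - d" using T[of t] \<open>t0 \<le> t\<close> t0 by auto
      qed (use t1 in \<open>auto intro!: derivative_eq_intros der'\<close>)
      moreover have "d * (t1 - t0) = 3" using d by (simp add: t1_def)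
      ultimately have "f t0 + 3 \<le> f t1" by (simp add: algebra_simps)
      then show False using range[of t0] range[of t1] t0 t1 by (auto simp: abs_le_iff)
    qed
    then obtain t1 where t1: "t1 \<ge> t0" "1 - k \<le> f t1" by blast
    have "1 - k \<le> f t" if "t \<ge> t1" for t
    proof (rule barrier_halfline[OF der'[of t1] _ t1(2) that])
      fix t assume "t1 \<le> t" "f t = 1 - k"
      then have "d \<le> f' t" using T[of t] k t1 t0 by auto
      then show "0 < f' t" using d by simp
    qed (use t1 in auto)
    then show ?thesis by (auto simp: eventually_at_top_linorder)
  qed note ev = this
  have "(f \<longlongrightarrow> 1) at_top"
  proof (rule tendstoI)
    fix r :: real assume r: "r > 0"
    define k where "k = min (min (1/2) e) (r/2)"
    have "eventually (\<lambda>t. 1 - k \<le> f t) at_top"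
      by (rule ev) (use e r in \<open>auto simp: k_def\<close>)
    moreover have "eventually (\<lambda>t. a \<le> t) at_top" by (rule eventually_ge_at_top)
    ultimately show "eventually (\<lambda>t. dist (f t) 1 < r) at_top"
    proof eventually_elim
      case (elim t)
      have "k < r" using r by (simp add: k_def)
      then show ?case using elim range[of t] by (auto simp: dist_real_def abs_if)
    qed
  qed
  then show ?thesis ..
qed simp

text \<open>By the mean value inequality the difference quotients are bounded by the constant
  \<open>B\<close>, so dominated convergence applies along every sequence tending to
  \<open>t\<close>. Measurability of \<open>f' t\<close> comes for free, as a pointwise limit of the
  quotients.\<close>

lemma (in finite_measure) has_real_derivative_integral:
  fixes f f' :: "real \<Rightarrow> 'a \<Rightarrow> real"
  assumes meas: "\<And>t. a \<le> t \<Longrightarrow> f t \<in> borel_measurable M"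
    and bound: "\<And>t x. a \<le> t \<Longrightarrow> \<bar>f t x\<bar> \<le> C"
    and der: "\<And>t x. a \<le> t \<Longrightarrow> ((\<lambda>s. f s x) has_real_derivative f' t x) (at t within {a..})"
    and bound': "\<And>t x. a \<le> t \<Longrightarrow> \<bar>f' t x\<bar> \<le> B"
    and "a \<le> t"
  shows "((\<lambda>s. \<integral>x. f s x \<partial>M) has_real_derivative (\<integral>x. f' t x \<partial>M)) (at t within {a..})"
proof -
  have int: "integrable M (f s)" if "a \<le> s" for s
    by (rule integrable_const_bound[where B=C]) (use meas bound that in auto)
  have lip: "\<bar>f s x - f t x\<bar> \<le> B * \<bar>s - t\<bar>" if "a \<le> s" for s x
  proof -
    have "norm (f s x - f t x) \<le> B * norm (s - t)"
      by (rule field_differentiable_bound[of "{a..}" "\<lambda>s. f s x" "\<lambda>s. f' s x"])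
        (use der bound' that \<open>a \<le> t\<close> in auto)
    then show ?thesis by simp
  qed
  show ?thesis
    unfolding has_field_derivative_iff tendsto_at_iff_sequentially
  proof (intro allI impI)
    fix X :: "nat \<Rightarrow> real"
    assume X: "\<forall>i. X i \<in> {a..} - {t}" "X \<longlonglongrightarrow> t"
    have Xa: "a \<le> X i" "X i \<noteq> t" for i using X by auto
    have lim: "(\<lambda>i. (f (X i) x - f t x) / (X i - t)) \<longlonglongrightarrow> f' t x" for x
      using der[OF \<open>a \<le> t\<close>, of x] X
      unfolding has_field_derivative_iff tendsto_at_iff_sequentially
      by (auto simp: o_def)
    have "(\<lambda>i. \<integral>x. (f (X i) x - f t x) / (X i - t) \<partial>M) \<longlonglongrightarrow> (\<integral>x. f' t x \<partial>M)"
    proof (rule integral_dominated_convergence[where w="\<lambda>_. B"])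
      show m: "(\<lambda>x. (f (X i) x - f t x) / (X i - t)) \<in> borel_measurable M" for i
        using meas[OF Xa(1)] meas[OF \<open>a \<le> t\<close>] by measurable
      show "f' t \<in> borel_measurable M"
        by (rule borel_measurable_LIMSEQ_real[OF lim m])
      show "AE x in M. norm ((f (X i) x - f t x) / (X i - t)) \<le> B" for i
        using lip[OF Xa(1)] Xa by (auto simp: field_simps)
    qed (use lim in auto)
    moreover have "(\<integral>x. (f (X i) x - f t x) / (X i - t) \<partial>M)
        = ((\<integral>x. f (X i) x \<partial>M) - (\<integral>x. f t x \<partial>M)) / (X i - t)" for i
      using int Xa \<open>a \<le> t\<close> by (simp only: integral_divide_zero Bochner_Integration.integral_diff)
    ultimately show "((\<lambda>s. ((\<integral>x. f s x \<partial>M) - (\<integral>x. f t x \<partial>M)) / (s - t)) \<circ> X)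
        \<longlonglongrightarrow> (\<integral>x. f' t x \<partial>M)"
      by (simp only: o_def)
  qed
qed

text \<open>Both \<open>L\<close> and \<open>f + L\<close> are nondecreasing and bounded above, so
  both converge, and so does their difference. This is bounded variation with \<open>L\<close> as
  the controlling function.\<close>

lemma convergent_of_dist_le_increment:
  fixes f L :: "real \<Rightarrow> real"
  assumes inc: "\<And>s t. T \<le> s \<Longrightarrow> s \<le> t \<Longrightarrow> \<bar>f t - f s\<bar> \<le> L t - L s"
    and B: "\<And>t. T \<le> t \<Longrightarrow> L t \<le> B"
  shows "\<exists>l. (f \<longlongrightarrow> l) at_top"
proof -
  have mono: "L s \<le> L t" if "T \<le> s" "s \<le> t" for s t using inc[OF that] by linarith
  have bounded: "\<exists>l. (g \<longlongrightarrow> l) at_top"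
    if g: "\<And>s t. T \<le> s \<Longrightarrow> s \<le> t \<Longrightarrow> g s \<le> g t" "\<And>t. T \<le> t \<Longrightarrow> g t \<le> C" for g :: "real \<Rightarrow> real" and C
  proof -
    define l where "l = (SUP t\<in>{T..}. g t)"
    have bdd: "bdd_above (g ` {T..})" using g by (auto simp: bdd_above_def)
    have "(g \<longlongrightarrow> l) at_top"
    proof (rule order_tendstoI)
      fix b assume "b < l"
      then obtain t where "T \<le> t" "b < g t"
        unfolding l_def using less_cSUP_iff[OF _ bdd] by auto
      then show "eventually (\<lambda>t. b < g t) at_top"
        unfolding eventually_at_top_linorder by (meson g(1) less_le_trans)
    next
      fix b assume "l < b"
      have "g t \<le> l" if "T \<le> t" for t
        unfolding l_def by (rule cSUP_upper[OF _ bdd]) (use that in auto)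
      then show "eventually (\<lambda>t. g t < b) at_top"
        unfolding eventually_at_top_linorder using \<open>l < b\<close> by (meson le_less_trans)
    qed
    then show ?thesis by blast
  qed
  have "\<exists>l. (L \<longlongrightarrow> l) at_top" by (rule bounded[OF mono B])
  then obtain l where l: "(L \<longlongrightarrow> l) at_top" by blast
  have "\<exists>m. ((\<lambda>t. f t + L t) \<longlongrightarrow> m) at_top"
  proof (rule bounded)
    fix t assume t: "T \<le> t"
    show "f t + L t \<le> f T - L T + 2 * B" using inc[OF _ t] B[OF t] by auto
  next
    fix s t assume "T \<le> s" "s \<le> t"
    then show "f s + L s \<le> f t + L t" using inc[of s t] by auto
  qed
  then obtain m where "((\<lambda>t. f t + L t) \<longlongrightarrow> m) at_top" by blast
  from tendsto_diff[OF this l] show ?thesis by auto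
qed

lemma (in finite_measure) tendsto_integral_bounded_at_top:
  fixes f :: "real \<Rightarrow> 'a \<Rightarrow> real"
  assumes meas: "\<And>t. 0 \<le> t \<Longrightarrow> f t \<in> borel_measurable M"
    and bound: "\<And>t x. 0 \<le> t \<Longrightarrow> \<bar>f t x\<bar> \<le> B"
    and g: "g \<in> borel_measurable M"
    and lim: "AE x in M. ((\<lambda>t. f t x) \<longlongrightarrow> g x) at_top"
  shows "((\<lambda>t. \<integral>x. f t x \<partial>M) \<longlongrightarrow> (\<integral>x. g x \<partial>M)) at_top"
proof -
  \<comment> \<open>Composing with \<open>max 0\<close> makes the hypotheses hold at every real time
    and changes nothing eventually.\<close>
  have "((\<lambda>t. \<integral>x. f (max 0 t) x \<partial>M) \<longlongrightarrow> (\<integral>x. g x \<partial>M)) at_top"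
  proof (rule integral_dominated_convergence_at_top[where w="\<lambda>_. B"])
    show "AE x in M. ((\<lambda>t. f (max 0 t) x) \<longlongrightarrow> g x) at_top"
      using lim
    proof eventually_elim
      case (elim x)
      have "eventually (\<lambda>t::real. f t x = f (max 0 t) x) at_top"
        using eventually_ge_at_top[of 0] by eventually_elim simp
      then show ?case using elim by (rule Lim_transform_eventually[rotated])
    qed
  qed (use meas bound g in auto)
  moreover have "eventually (\<lambda>t::real. (\<integral>x. f (max 0 t) x \<partial>M) = (\<integral>x. f t x \<partial>M)) at_top"
    using eventually_ge_at_top[of 0] by eventually_elim simp
  ultimately show ?thesis by (rule Lim_transform_eventually)
qed

section \<open>Square roots smoothed at zero\<close>

lemma abs_sqrt_le: "0 \<le> y \<Longrightarrow> y \<le> B\<^sup>2 \<Longrightarrow> 0 \<le> B \<Longrightarrow> \<bar>sqrt y\<bar> \<le> B"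
  by (simp add: real_le_lsqrt)

text \<open>The right side arises when \<open>sqrt (a\<^sup>2 + e\<^sup>2)\<close> is differentiated
  along a linear growth of \<open>a\<close>; it falls short of \<open>\<bar>a\<bar>\<close> by at
  most \<open>e\<close> because the root is at most \<open>\<bar>a\<bar> + e\<close>.\<close>

lemma smoothed_abs_ge:
  fixes a e :: real
  assumes e: "0 < e"
  shows "\<bar>a\<bar> - e \<le> a\<^sup>2 / sqrt (a\<^sup>2 + e\<^sup>2)"
proof (cases "\<bar>a\<bar> \<le> e")
  case False
  have "sqrt (a\<^sup>2 + e\<^sup>2) \<le> \<bar>a\<bar> + e"
    using sqrt_add_le_add_sqrt[of "a\<^sup>2" "e\<^sup>2"] e by simp
  then have "(\<bar>a\<bar> - e) * sqrt (a\<^sup>2 + e\<^sup>2) \<le> (\<bar>a\<bar> - e) * (\<bar>a\<bar> + e)"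
    using False by (intro mult_left_mono) auto
  also have "\<dots> \<le> a\<^sup>2" by (simp add: algebra_simps power2_eq_square)
  finally show ?thesis using e by (simp add: pos_le_divide_eq add_nonneg_pos)
next
  case True
  have "0 \<le> a\<^sup>2 / sqrt (a\<^sup>2 + e\<^sup>2)" by simp
  then show ?thesis using True by linarith
qed

text \<open>The right side is the derivative of \<open>2 * sqrt (1 + c + e\<^sup>2)\<close> when
  \<open>c' = (R * s + q) * s\<close>. With \<open>a = sqrt (1 + c)\<close> and
  \<open>b = sqrt (1 - c)\<close> one has \<open>\<bar>s\<bar> = a * b\<close>. Without smoothing
  the \<open>R\<close> term is \<open>R * a * b\<^sup>2\<close>, which \<open>b <= 2\<close>
  compares with \<open>R / 2 * (\<bar>s\<bar> * (1 - c))\<close>, and the \<open>q\<close> term is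
  at most \<open>\<bar>q\<bar> * b\<close>. Smoothing costs \<open>2 * e\<close>.\<close>

lemma smoothed_drift_bound:
  fixes c s R q e :: real
  assumes cs: "s\<^sup>2 = 1 - c\<^sup>2" and c: "\<bar>c\<bar> \<le> 1" and e: "0 < e" and R: "0 \<le> R" "R \<le> 1"
  shows "R / 2 * (\<bar>s\<bar> * (1 - c)) - 2 * e - \<bar>q\<bar> * sqrt (1 - c)
    \<le> s * (R * s + q) / sqrt (1 + c + e\<^sup>2)"
proof -
  define a where "a = sqrt (1 + c)"
  define b where "b = sqrt (1 - c)"
  define w where "w = sqrt (1 + c + e\<^sup>2)"
  have a: "0 \<le> a" "a\<^sup>2 = 1 + c" and b: "0 \<le> b" "b\<^sup>2 = 1 - c"
    using c by (auto simp: a_def b_def)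
  have w: "0 < w" "w\<^sup>2 = a\<^sup>2 + e\<^sup>2"
    using c e by (auto simp: w_def a add_nonneg_pos)
  have "s\<^sup>2 = (a * b)\<^sup>2"
    unfolding power_mult_distrib a b cs by (simp add: algebra_simps power2_eq_square)
  then have s: "\<bar>s\<bar> = a * b" using a b by (metis abs_of_nonneg mult_nonneg_nonneg power2_eq_iff_nonneg abs_ge_zero power2_abs)
  have "a \<le> w" by (rule power2_le_imp_le) (use w in auto)
  have aw: "a - e \<le> a\<^sup>2 / w"
    using smoothed_abs_ge[OF e, of a] a w_def by (simp add: add.assoc)
  have "b \<le> 2" by (rule power2_le_imp_le) (use b c in auto)
  have "a * b * b\<^sup>2 \<le> 2 * (a * b\<^sup>2)"
    using mult_right_mono[OF \<open>b \<le> 2\<close>, of "a * b\<^sup>2"] a(1) by (simp add: ac_simps)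
  moreover have "b\<^sup>2 * (a - e) \<le> b\<^sup>2 * (a\<^sup>2 / w)" by (rule mult_left_mono[OF aw]) simp
  moreover have "b\<^sup>2 * e \<le> 2 * e" using b c e by (intro mult_right_mono) auto
  ultimately have "a * b * b\<^sup>2 / 2 - 2 * e \<le> (a * b)\<^sup>2 / w"
    by (simp add: algebra_simps power_mult_distrib)
  then have "R * (a * b * b\<^sup>2 / 2 - 2 * e) \<le> R * ((a * b)\<^sup>2 / w)"
    using R by (intro mult_left_mono)
  moreover have "R * e \<le> e" using R e by (simp add: mult_left_le_one_le)
  ultimately have 1: "R / 2 * (\<bar>s\<bar> * (1 - c)) - 2 * e \<le> R * s\<^sup>2 / w"
    unfolding \<open>s\<^sup>2 = (a * b)\<^sup>2\<close> s b(2)[symmetric] by (simp add: right_diff_distrib)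
  have "\<bar>q * s / w\<bar> = \<bar>q\<bar> * (a / w * b)" using w by (simp add: abs_mult s)
  also have "\<dots> \<le> \<bar>q\<bar> * (1 * b)"
    using \<open>a \<le> w\<close> w b by (intro mult_left_mono mult_right_mono) auto
  finally have "- (\<bar>q\<bar> * b) \<le> q * s / w" by linarith
  moreover have "s * (R * s + q) / w = R * s\<^sup>2 / w + q * s / w"
    by (simp add: algebra_simps add_divide_distrib power2_eq_square)
  ultimately show ?thesis
    using 1 unfolding b_def[symmetric] w_def[symmetric] by linarith
qed

lemma smoothed_abs_deriv:
  fixes f :: "real \<Rightarrow> real"
  assumes f: "(f has_real_derivative D) (at t within A)" and e: "0 < e"
  shows "((\<lambda>t. sqrt ((f t)\<^sup>2 + e\<^sup>2)) has_real_derivative f t * D / sqrt ((f t)\<^sup>2 + e\<^sup>2))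
    (at t within A)"
proof -
  have pos: "0 < (f t)\<^sup>2 + e\<^sup>2" using e by (simp add: add_nonneg_pos)
  have g: "((\<lambda>t. (f t)\<^sup>2 + e\<^sup>2) has_real_derivative 2 * (f t * D)) (at t within A)"
    by (rule DERIV_cong[OF DERIV_add[OF DERIV_power[OF f, where n=2] DERIV_const]]) simp
  show ?thesis
    by (rule DERIV_cong[OF DERIV_chain2[OF DERIV_real_sqrt g]]) (rule pos, simp add: inverse_eq_divide)
qed

section \<open>Continuous functions on the circle\<close>

lemma circ_cont_periodic:
  assumes "circ_cont f"
  shows "f (x + 2 * pi * of_int n) = f x"
proof -
  have per: "f (x + 2 * pi) = f x" for x using assms by (auto simp: circ_cont_def)
  have nat: "f (x + 2 * pi * real n) = f x" for x n
  proof (induction n)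
    case (Suc n)
    then show ?case using per[of "x + 2 * pi * real n"] by (simp add: algebra_simps)
  qed simp
  show ?thesis
  proof (cases "0 \<le> n")
    case True
    then show ?thesis using nat[of x "nat n"] by simp
  next
    case False
    then show ?thesis using nat[of "x + 2 * pi * of_int n" "nat (- n)"] by simp
  qed
qed

lemma circ_cont_bounded:
  assumes "circ_cont f"
  obtains B where "\<And>x. \<bar>f x\<bar> \<le> B"
proof -
  have "continuous_on UNIV f" using assms by (simp add: circ_cont_def)
  then have "continuous_on {0..2*pi} f" by (rule continuous_on_subset) simp
  then have "bounded (f ` {0..2*pi})"
    by (intro compact_imp_bounded compact_continuous_image) simp_all
  then obtain B where B: "\<And>x. x \<in> {0..2*pi} \<Longrightarrow> \<bar>f x\<bar> \<le> B"
    unfolding bounded_real by blast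
  have "\<bar>f x\<bar> \<le> B" for x
  proof -
    define n where "n = \<lfloor>x / (2 * pi)\<rfloor>"
    have "of_int n \<le> x / (2 * pi)" "x / (2 * pi) \<le> of_int n + 1"
      unfolding n_def by linarith+
    then have "x + 2 * pi * of_int (- n) \<in> {0..2*pi}" by (simp add: field_simps)
    from B[OF this] show ?thesis by (simp only: circ_cont_periodic[OF assms])
  qed
  then show thesis by (rule that)
qed

text \<open>The lift \<open>x t\<close> may wind around the circle without converging. It is
  replaced by the equivalent lift \<open>y + Arg (cis (x t - y))\<close>: rotation by
  \<open>- y\<close> moves the limit to 1, where \<open>Arg\<close> is continuous.\<close>

lemma circ_cont_tendsto:
  assumes f: "circ_cont f"
    and c: "((\<lambda>t. cos (x t)) \<longlongrightarrow> cos y) F" and s: "((\<lambda>t. sin (x t)) \<longlongrightarrow> sin y) F"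
  shows "((\<lambda>t. f (x t)) \<longlongrightarrow> f y) F"
proof -
  have "((\<lambda>t. Complex (cos (x t)) (sin (x t)) * cis (- y)) \<longlongrightarrow> Complex (cos y) (sin y) * cis (- y)) F"
    by (intro tendsto_intros tendsto_Complex c s)
  moreover have "Complex (cos a) (sin a) * cis (- y) = cis (a - y)" for a
    by (simp add: cis_mult flip: cis.ctr)
  ultimately have lim: "((\<lambda>t. cis (x t - y)) \<longlongrightarrow> 1) F" by simp
  have "((\<lambda>t. Arg (cis (x t - y))) \<longlongrightarrow> Arg 1) F"
    by (rule isCont_tendsto_compose[OF continuous_at_Arg lim]) simp
  then have "((\<lambda>t. y + Arg (cis (x t - y))) \<longlongrightarrow> y + 0) F" by (intro tendsto_intros) simp
  moreover have "isCont f y" using f by (simp add: circ_cont_def continuous_on_eq_continuous_at)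
  ultimately have "((\<lambda>t. f (y + Arg (cis (x t - y)))) \<longlongrightarrow> f y) F"
    using isCont_tendsto_compose[of y f] by simp
  moreover have "f (y + Arg (cis (x t - y))) = f (x t)" for t
  proof -
    have "cis (Arg (cis (x t - y))) = cis (x t - y)" by (simp add: cis_Arg sgn_div_norm)
    then have "sin (x t - y) = sin (Arg (cis (x t - y))) \<and> cos (x t - y) = cos (Arg (cis (x t - y)))"
      by (simp add: complex_eq_iff)
    then obtain n :: int where "x t - y = Arg (cis (x t - y)) + 2 * pi * n"
      unfolding sin_cos_eq_iff by blast
    then have "x t = y + Arg (cis (x t - y)) + 2 * pi * n" by simp
    then show ?thesis using circ_cont_periodic[OF f] by metis
  qed
  ultimately show ?thesis by simp
qed

section \<open>The order parameter\<close>

locale kuramoto_flow = prob_space M for M :: "'a measure" +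
  fixes \<Theta> :: "real \<Rightarrow> 'a \<Rightarrow> real" and R \<phi> :: "real \<Rightarrow> real"
  assumes flow_measurable: "\<And>t. 0 \<le> t \<Longrightarrow> \<Theta> t \<in> borel_measurable M"
    and flow_deriv: "\<And>t x. 0 \<le> t \<Longrightarrow>
      ((\<lambda>s. \<Theta> s x) has_real_derivative (- R t * sin (\<Theta> t x - \<phi> t))) (at t within {0..})"
    and R_nonneg: "\<And>t. 0 \<le> t \<Longrightarrow> 0 \<le> R t"
    and order_parameter: "\<And>t. 0 \<le> t \<Longrightarrow>
      complex_of_real (R t) * cis (\<phi> t) = (\<integral>x. cis (\<Theta> t x) \<partial>M)"
begin

definition co :: "real \<Rightarrow> 'a \<Rightarrow> real" where "co t x = cos (\<Theta> t x - \<phi> t)"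
definition si :: "real \<Rightarrow> 'a \<Rightarrow> real" where "si t x = sin (\<Theta> t x - \<phi> t)"
definition S :: "real \<Rightarrow> real" where "S t = (\<integral>x. (si t x)\<^sup>2 \<partial>M)"
text \<open>\<open>\<phi>\<close> is only some choice of argument and may jump by multiples of 2 pi,
  so its speed is defined by an integral and not as a derivative.\<close>

definition q :: "real \<Rightarrow> real" where "q t = - (\<integral>x. si t x * co t x \<partial>M)"

lemma measurable_co [measurable]: "0 \<le> t \<Longrightarrow> co t \<in> borel_measurable M"
  and measurable_si [measurable]: "0 \<le> t \<Longrightarrow> si t \<in> borel_measurable M"
  unfolding co_def si_def using flow_measurable[of t] by measurable

lemma abs_co: "\<bar>co t x\<bar> \<le> 1" and abs_si: "\<bar>si t x\<bar> \<le> 1"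
  by (simp_all add: co_def si_def)

lemma si_sq: "(si t x)\<^sup>2 = 1 - (co t x)\<^sup>2"
  by (simp add: co_def si_def sin_squared_eq)

lemma integrable_bounded:
  "f \<in> borel_measurable M \<Longrightarrow> (\<And>x. \<bar>f x\<bar> \<le> B) \<Longrightarrow> integrable M (f :: 'a \<Rightarrow> real)"
  by (rule integrable_const_bound[where B=B]) auto

lemma abs_mult_le_1: "\<bar>a\<bar> \<le> 1 \<Longrightarrow> \<bar>b\<bar> \<le> 1 \<Longrightarrow> \<bar>a * b\<bar> \<le> (1::real)"
  by (simp add: abs_mult mult_le_one)

lemma integral_bounded_le:
  fixes f :: "'a \<Rightarrow> real"
  assumes "f \<in> borel_measurable M" "\<And>x. \<bar>f x\<bar> \<le> B"
  shows "\<bar>\<integral>x. f x \<partial>M\<bar> \<le> B"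
proof -
  have "\<bar>\<integral>x. f x \<partial>M\<bar> \<le> (\<integral>x. \<bar>f x\<bar> \<partial>M)" by (rule integral_abs_bound)
  also have "\<dots> \<le> (\<integral>x. B \<partial>M)"
    using assms by (intro integral_mono integrable_abs integrable_bounded) auto
  finally show ?thesis by (simp add: prob_space)
qed

context
  fixes t :: real
  assumes t: "0 \<le> t"
begin

lemma measurable_flow [measurable]: "\<Theta> t \<in> borel_measurable M"
  by (rule flow_measurable[OF t])

lemma order_cos: "R t * cos (\<phi> t) = (\<integral>x. cos (\<Theta> t x) \<partial>M)"
  and order_sin: "R t * sin (\<phi> t) = (\<integral>x. sin (\<Theta> t x) \<partial>M)"
proof -
  have "cis \<in> borel_measurable borel"
    by (intro borel_measurable_continuous_onI continuous_intros)
  then have "(\<lambda>x. cis (\<Theta> t x)) \<in> borel_measurable M" by measurable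
  then have int: "integrable M (\<lambda>x. cis (\<Theta> t x))"
    by (intro integrable_const_bound[where B=1]) auto
  show "R t * cos (\<phi> t) = (\<integral>x. cos (\<Theta> t x) \<partial>M)"
    using arg_cong[OF order_parameter[OF t], of Re] integral_Re[OF int] by simp
  show "R t * sin (\<phi> t) = (\<integral>x. sin (\<Theta> t x) \<partial>M)"
    using arg_cong[OF order_parameter[OF t], of Im] integral_Im[OF int] by simp
qed

lemma integrable_trig:
  "integrable M (\<lambda>x. cos (\<Theta> t x))" "integrable M (\<lambda>x. sin (\<Theta> t x))"
  "integrable M (co t)" "integrable M (si t)"
  "integrable M (\<lambda>x. (si t x)\<^sup>2)" "integrable M (\<lambda>x. si t x * co t x)"
  using t by (auto intro!: integrable_bounded[where B=1] abs_mult_le_1 abs_co abs_si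
    simp: power2_eq_square)

text \<open>This and \<open>integral_si\<close> are the real and imaginary parts of the order
  parameter after rotation by \<open>- \<phi> t\<close>.\<close>

lemma integral_co: "(\<integral>x. co t x \<partial>M) = R t"
proof -
  have "(\<integral>x. co t x \<partial>M) = (\<integral>x. cos (\<Theta> t x) * cos (\<phi> t) + sin (\<Theta> t x) * sin (\<phi> t) \<partial>M)"
    by (simp add: co_def cos_diff)
  also have "\<dots> = R t * ((cos (\<phi> t))\<^sup>2 + (sin (\<phi> t))\<^sup>2)"
    using integrable_trig
    by (simp add: distrib_left power2_eq_square mult.assoc flip: order_cos order_sin del: sin_cos_squared_add3)
  finally show ?thesis by simp
qed

lemma integral_si: "(\<integral>x. si t x \<partial>M) = 0"
proof -
  have "(\<integral>x. si t x \<partial>M) = (\<integral>x. sin (\<Theta> t x) * cos (\<phi> t) - cos (\<Theta> t x) * sin (\<phi> t) \<partial>M)"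
    by (simp add: si_def sin_diff)
  also have "\<dots> = 0"
    using integrable_trig by (simp flip: order_cos order_sin)
  finally show ?thesis .
qed

lemma R_le_1: "R t \<le> 1"
  using integral_bounded_le[of "co t" 1] abs_co t by (simp add: integral_co abs_le_iff)

lemma S_nonneg: "0 \<le> S t" and S_le_1: "S t \<le> 1"
  using integral_bounded_le[of "\<lambda>x. (si t x)\<^sup>2" 1] t abs_si
  by (auto simp: S_def power_le_one_iff abs_square_le_1)

text \<open>Nonnegativity of the variance of \<open>si * co\<close> bounds
  \<open>(q t)\<^sup>2\<close> by the mean of its square, and \<open>\<bar>co\<bar> <= 1\<close>
  bounds that mean by \<open>S t\<close>. Decay of \<open>S\<close> thus passes to
  \<open>q\<close>.\<close>

lemma q_sq_le_S: "(q t)\<^sup>2 \<le> S t"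
proof -
  have int: "integrable M (\<lambda>x. (si t x * co t x)\<^sup>2)"
    using t by (intro integrable_bounded[where B=1]) (auto simp: power_mult_distrib
      intro!: mult_le_one abs_mult_le_1 simp: abs_square_le_1 abs_co abs_si)
  have "0 \<le> variance (\<lambda>x. si t x * co t x)" by (rule variance_positive)
  also have "\<dots> = (\<integral>x. (si t x * co t x)\<^sup>2 \<partial>M) - (q t)\<^sup>2"
    using integrable_trig int by (subst variance_eq) (auto simp: q_def)
  also have "(\<integral>x. (si t x * co t x)\<^sup>2 \<partial>M) \<le> S t"
    unfolding S_def
    by (intro integral_mono int integrable_trig)
      (auto simp: power_mult_distrib abs_square_le_1 abs_co intro!: mult_left_le)
  finally show ?thesis by simp
qed

lemma abs_q_le_1: "\<bar>q t\<bar> \<le> 1"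
  using q_sq_le_S S_le_1 by (simp add: abs_square_le_1[symmetric])

text \<open>The real part of the order parameter is differentiated under the integral, and
  \<open>sin \<Theta>\<close> is then expanded about the mean phase. The product
  \<open>R * cos \<phi>\<close> is differentiable even where \<open>R\<close> vanishes and
  \<open>\<phi>\<close> is arbitrary.\<close>

lemma order_cos_deriv:
  "((\<lambda>t. R t * cos (\<phi> t)) has_real_derivative R t * (S t * cos (\<phi> t) - q t * sin (\<phi> t)))
    (at t within {0..})"
proof -
  have "((\<lambda>t. \<integral>x. cos (\<Theta> t x) \<partial>M) has_real_derivative
      (\<integral>x. R t * (si t x * sin (\<Theta> t x)) \<partial>M)) (at t within {0..})"
  proof (rule has_real_derivative_integral[where C=1 and B=1])
    fix t x assume t: "0 \<le> (t::real)"
    show "(\<lambda>x. cos (\<Theta> t x)) \<in> borel_measurable M"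
      using flow_measurable[OF t] by measurable
    show "((\<lambda>s. cos (\<Theta> s x)) has_real_derivative R t * (si t x * sin (\<Theta> t x))) (at t within {0..})"
      by (rule derivative_eq_intros flow_deriv t)+ (simp add: si_def)
    show "\<bar>R t * (si t x * sin (\<Theta> t x))\<bar> \<le> 1"
      using kuramoto_flow.R_le_1[OF kuramoto_flow_axioms t] R_nonneg[OF t]
      by (intro abs_mult_le_1 abs_si) auto
  qed (use t in auto)
  also have "(\<integral>x. R t * (si t x * sin (\<Theta> t x)) \<partial>M)
      = (\<integral>x. R t * ((si t x)\<^sup>2 * cos (\<phi> t) + si t x * co t x * sin (\<phi> t)) \<partial>M)"
  proof (intro Bochner_Integration.integral_cong refl)
    fix x
    have "sin (\<Theta> t x) = si t x * cos (\<phi> t) + co t x * sin (\<phi> t)"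
      using sin_add[of "\<Theta> t x - \<phi> t" "\<phi> t"] by (simp add: si_def co_def)
    then show "R t * (si t x * sin (\<Theta> t x))
        = R t * ((si t x)\<^sup>2 * cos (\<phi> t) + si t x * co t x * sin (\<phi> t))"
      by (simp only:) (simp add: algebra_simps power2_eq_square)
  qed
  also have "\<dots> = R t * (S t * cos (\<phi> t) - q t * sin (\<phi> t))"
    using integrable_trig by (simp add: S_def q_def)
  finally show ?thesis
    by (rule has_field_derivative_transform_within[where d=1])
      (use t in \<open>auto simp: kuramoto_flow.order_cos[OF kuramoto_flow_axioms]\<close>)
qed

lemma order_sin_deriv:
  "((\<lambda>t. R t * sin (\<phi> t)) has_real_derivative R t * (S t * sin (\<phi> t) + q t * cos (\<phi> t)))
    (at t within {0..})"
proof -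
  have "((\<lambda>t. \<integral>x. sin (\<Theta> t x) \<partial>M) has_real_derivative
      (\<integral>x. - R t * (si t x * cos (\<Theta> t x)) \<partial>M)) (at t within {0..})"
  proof (rule has_real_derivative_integral[where C=1 and B=1])
    fix t x assume t: "0 \<le> (t::real)"
    show "(\<lambda>x. sin (\<Theta> t x)) \<in> borel_measurable M"
      using flow_measurable[OF t] by measurable
    show "((\<lambda>s. sin (\<Theta> s x)) has_real_derivative - R t * (si t x * cos (\<Theta> t x))) (at t within {0..})"
      by (rule derivative_eq_intros flow_deriv t)+ (simp add: si_def)
    show "\<bar>- R t * (si t x * cos (\<Theta> t x))\<bar> \<le> 1"
      using kuramoto_flow.R_le_1[OF kuramoto_flow_axioms t] R_nonneg[OF t]
      by (intro abs_mult_le_1 abs_si) auto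
  qed (use t in auto)
  also have "(\<integral>x. - R t * (si t x * cos (\<Theta> t x)) \<partial>M)
      = (\<integral>x. R t * ((si t x)\<^sup>2 * sin (\<phi> t) - si t x * co t x * cos (\<phi> t)) \<partial>M)"
  proof (intro Bochner_Integration.integral_cong refl)
    fix x
    have "cos (\<Theta> t x) = co t x * cos (\<phi> t) - si t x * sin (\<phi> t)"
      using cos_add[of "\<Theta> t x - \<phi> t" "\<phi> t"] by (simp add: si_def co_def)
    then show "- R t * (si t x * cos (\<Theta> t x))
        = R t * ((si t x)\<^sup>2 * sin (\<phi> t) - si t x * co t x * cos (\<phi> t))"
      by (simp only:) (simp add: algebra_simps power2_eq_square)
  qed
  also have "\<dots> = R t * (S t * sin (\<phi> t) + q t * cos (\<phi> t))"
    using integrable_trig by (simp add: S_def q_def)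
  finally show ?thesis
    by (rule has_field_derivative_transform_within[where d=1])
      (use t in \<open>auto simp: kuramoto_flow.order_sin[OF kuramoto_flow_axioms]\<close>)
qed

text \<open>The square is the sum of squares of the two components, hence differentiable also where
  \<open>R\<close> vanishes; the \<open>q\<close> terms cancel, since rotation does not change the
  modulus.\<close>

lemma R_sq_deriv:
  "((\<lambda>t. (R t)\<^sup>2) has_real_derivative 2 * (R t)\<^sup>2 * S t) (at t within {0..})"
proof -
  have "((\<lambda>t. (R t * cos (\<phi> t))\<^sup>2 + (R t * sin (\<phi> t))\<^sup>2) has_real_derivative
      2 * (R t)\<^sup>2 * S t * ((sin (\<phi> t))\<^sup>2 + (cos (\<phi> t))\<^sup>2)) (at t within {0..})"
    by (rule DERIV_cong[OF DERIV_add[OF DERIV_power[OF order_cos_deriv, of 2]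
          DERIV_power[OF order_sin_deriv, of 2]]])
      (simp add: algebra_simps power2_eq_square
        del: sin_cos_squared_add sin_cos_squared_add2 sin_cos_squared_add3)
  moreover have "(R t * cos (\<phi> t))\<^sup>2 + (R t * sin (\<phi> t))\<^sup>2 = (R t)\<^sup>2" for t
    by (simp add: power_mult_distrib flip: distrib_left)
  ultimately show ?thesis by simp
qed

end

section \<open>Growth of the order parameter, and incoherent data\<close>

lemma R_mono:
  assumes "0 \<le> s" "s \<le> t"
  shows "R s \<le> R t"
proof -
  have "(R s)\<^sup>2 \<le> (R t)\<^sup>2"
    by (rule mono_of_deriv_nonneg_halfline[OF R_sq_deriv, where T=0])
      (use assms S_nonneg in auto)
  then show ?thesis using R_nonneg[of t] assms by (simp add: power2_le_iff_abs_le)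
qed

text \<open>Since \<open>S \<le> 1\<close>, an incoherent initial state stays incoherent, and then nothing moves.\<close>

lemma R_zero:
  assumes "R 0 = 0" "0 \<le> t"
  shows "R t = 0"
proof -
  have "- (exp (- 2 * 0) * (R 0)\<^sup>2) \<le> - (exp (- 2 * t) * (R t)\<^sup>2)"
  proof (rule mono_of_deriv_nonneg_halfline[where a=0 and T=0 and
        f="\<lambda>t. - (exp (- 2 * t) * (R t)\<^sup>2)" and f'="\<lambda>t. 2 * exp (- 2 * t) * (R t)\<^sup>2 * (1 - S t)"])
    fix t :: real assume t: "0 \<le> t"
    show "((\<lambda>t. - (exp (- 2 * t) * (R t)\<^sup>2)) has_real_derivative
        2 * exp (- 2 * t) * (R t)\<^sup>2 * (1 - S t)) (at t within {0..})"
      by (rule derivative_eq_intros R_sq_deriv t refl)+ (simp add: algebra_simps)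
    show "0 \<le> 2 * exp (- 2 * t) * (R t)\<^sup>2 * (1 - S t)"
      using S_le_1[OF t] by simp
  qed (use assms in auto)
  then have "exp (- 2 * t) * (R t)\<^sup>2 \<le> 0" using assms by simp
  then show ?thesis by (simp add: mult_le_0_iff)
qed

lemma flow_constant_of_R_zero:
  assumes "R 0 = 0" "0 \<le> t"
  shows "\<Theta> t x = \<Theta> 0 x"
proof -
  have "(((\<lambda>s. \<Theta> s x)) has_real_derivative 0) (at s within {0..})" if "0 \<le> s" for s
    using flow_deriv[OF that, of x] R_zero[OF assms(1) that] by simp
  note const = this
  have "\<Theta> 0 x \<le> \<Theta> t x"
    by (rule mono_of_deriv_nonneg_halfline[OF const, where T=0]) (use assms in auto)
  moreover have "- \<Theta> 0 x \<le> - \<Theta> t x"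
    by (rule mono_of_deriv_nonneg_halfline[OF DERIV_minus[OF const], where T=0]) (use assms in auto)
  ultimately show ?thesis by simp
qed

end

section \<open>Characteristics of a coherent solution\<close>

locale kuramoto_coherent = kuramoto_flow +
  assumes R0_pos: "0 < R 0"
begin

lemma R_ge: "0 \<le> t \<Longrightarrow> R 0 \<le> R t"
  by (rule R_mono) auto

lemma R_pos: "0 \<le> t \<Longrightarrow> 0 < R t"
  by (rule less_le_trans[OF R0_pos R_ge])

lemma R_deriv:
  assumes t: "0 \<le> t"
  shows "(R has_real_derivative R t * S t) (at t within {0..})"
proof -
  have "((\<lambda>t. sqrt ((R t)\<^sup>2)) has_real_derivative R t * S t) (at t within {0..})"
    by (rule DERIV_cong[OF DERIV_chain2[OF DERIV_real_sqrt R_sq_deriv[OF t]]])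
      (use R_pos[OF t] in \<open>auto simp: field_simps power2_eq_square\<close>)
  then show ?thesis
    by (rule has_field_derivative_transform_within[where d=1]) (use t R_nonneg in auto)
qed

text \<open>Dividing the component \<open>R * cos \<phi>\<close> by \<open>R\<close> cancels the
  growth term \<open>S\<close> and leaves pure rotation at speed \<open>q\<close>; likewise for the
  sine below.\<close>

lemma cos_phase_deriv:
  assumes t: "0 \<le> t"
  shows "((\<lambda>t. cos (\<phi> t)) has_real_derivative - q t * sin (\<phi> t)) (at t within {0..})"
proof -
  have "((\<lambda>t. R t * cos (\<phi> t) / R t) has_real_derivative - q t * sin (\<phi> t)) (at t within {0..})"
    by (rule DERIV_cong[OF DERIV_divide[OF order_cos_deriv[OF t] R_deriv[OF t]]])
      (use R_pos[OF t] in \<open>auto simp: field_simps\<close>)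
  then show ?thesis
    by (rule has_field_derivative_transform_within[where d=1])
      (use t R_pos in \<open>auto simp: less_imp_neq[symmetric]\<close>)
qed

lemma sin_phase_deriv:
  assumes t: "0 \<le> t"
  shows "((\<lambda>t. sin (\<phi> t)) has_real_derivative q t * cos (\<phi> t)) (at t within {0..})"
proof -
  have "((\<lambda>t. R t * sin (\<phi> t) / R t) has_real_derivative q t * cos (\<phi> t)) (at t within {0..})"
    by (rule DERIV_cong[OF DERIV_divide[OF order_sin_deriv[OF t] R_deriv[OF t]]])
      (use R_pos[OF t] in \<open>auto simp: field_simps\<close>)
  then show ?thesis
    by (rule has_field_derivative_transform_within[where d=1])
      (use t R_pos in \<open>auto simp: less_imp_neq[symmetric]\<close>)
qed

text \<open>The relative phase moves with velocity \<open>- (R * si + q)\<close>. Expanding the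
  cosine of the difference needs only derivatives of \<open>cos \<phi>\<close> and
  \<open>sin \<phi>\<close>.\<close>

lemma co_deriv:
  assumes t: "0 \<le> t"
  shows "((\<lambda>t. co t x) has_real_derivative (R t * si t x + q t) * si t x) (at t within {0..})"
  unfolding co_def cos_diff
  by (rule derivative_eq_intros flow_deriv cos_phase_deriv sin_phase_deriv t refl)+
    (simp add: si_def co_def sin_diff algebra_simps)

lemma si_deriv:
  assumes t: "0 \<le> t"
  shows "((\<lambda>t. si t x) has_real_derivative - (R t * si t x + q t) * co t x) (at t within {0..})"
  unfolding si_def sin_diff
  by (rule derivative_eq_intros flow_deriv cos_phase_deriv sin_phase_deriv t refl)+
    (simp add: si_def co_def cos_diff sin_diff algebra_simps)

lemma abs_drift: "0 \<le> t \<Longrightarrow> \<bar>R t * si t x + q t\<bar> \<le> 2"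
  using abs_mult_le_1[of "R t" "si t x"] abs_si[of t x] R_le_1[of t] R_nonneg[of t] abs_q_le_1[of t]
  by simp

lemma S_deriv:
  assumes t: "0 \<le> t"
  shows "(S has_real_derivative (\<integral>x. - (2 * (si t x * co t x) * (R t * si t x + q t)) \<partial>M))
    (at t within {0..})"
  unfolding S_def
proof (rule has_real_derivative_integral[where C=1 and B=4])
  fix t :: real and x assume t: "0 \<le> t"
  show "((\<lambda>s. (si s x)\<^sup>2) has_real_derivative - (2 * (si t x * co t x) * (R t * si t x + q t)))
      (at t within {0..})"
    by (rule DERIV_cong[OF DERIV_power[OF si_deriv[OF t], where n=2]]) (simp add: algebra_simps)
  have "\<bar>si t x * co t x\<bar> * \<bar>R t * si t x + q t\<bar> \<le> 1 * 2"
    by (intro mult_mono abs_drift t abs_mult_le_1 abs_si abs_co) auto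
  then show "\<bar>- (2 * (si t x * co t x) * (R t * si t x + q t))\<bar> \<le> 4"
    by (simp add: abs_mult ac_simps)
qed (use t abs_si in \<open>auto simp: abs_square_le_1\<close>)

text \<open>Since \<open>R' = R * S\<close> and \<open>R\<close> is bounded, \<open>barbalat\<close>
  gives decay of \<open>R * S\<close>; the lower bound \<open>R 0\<close> for \<open>R\<close>
  transfers it to \<open>S\<close>.\<close>

lemma S_tendsto_0: "(S \<longlongrightarrow> 0) at_top"
proof -
  define S' where "S' t = (\<integral>x. - (2 * (si t x * co t x) * (R t * si t x + q t)) \<partial>M)" for t
  have S': "\<bar>S' t\<bar> \<le> 4" if t: "0 \<le> t" for t
    unfolding S'_def
  proof (rule integral_bounded_le)
    show "(\<lambda>x. - (2 * (si t x * co t x) * (R t * si t x + q t))) \<in> borel_measurable M"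
      using t by measurable
    fix x
    have "\<bar>si t x * co t x\<bar> * \<bar>R t * si t x + q t\<bar> \<le> 1 * 2"
      by (intro mult_mono abs_drift t abs_mult_le_1 abs_si abs_co) auto
    then show "\<bar>- (2 * (si t x * co t x) * (R t * si t x + q t))\<bar> \<le> 4"
      by (simp add: abs_mult ac_simps)
  qed
  have "((\<lambda>t. R t * S t) \<longlongrightarrow> 0) at_top"
  \<comment> \<open>\<open>K = 5\<close> is 1 for the term \<open>R * S * S\<close> plus 4 for
    \<open>S' * R\<close>.\<close>
  proof (rule barbalat[where a=0 and f=R and B=1 and K=5 and g'="\<lambda>t. R t * S t * S t + S' t * R t"])
    fix t :: real assume t: "0 \<le> t"
    show "((\<lambda>t. R t * S t) has_real_derivative R t * S t * S t + S' t * R t) (at t within {0..})"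
      unfolding S'_def by (rule DERIV_mult[OF R_deriv[OF t] S_deriv[OF t]])
    have "\<bar>R t * S t * S t\<bar> \<le> 1"
      using R_nonneg[OF t] R_le_1[OF t] S_nonneg[OF t] S_le_1[OF t]
      by (intro abs_mult_le_1) auto
    moreover have "\<bar>S' t\<bar> * \<bar>R t\<bar> \<le> 4 * 1"
      using R_nonneg[OF t] R_le_1[OF t] S'[OF t] by (intro mult_mono) auto
    ultimately show "\<bar>R t * S t * S t + S' t * R t\<bar> \<le> 5"
      using abs_triangle_ineq[of "R t * S t * S t" "S' t * R t"] unfolding abs_mult[of "S' t"] by linarith
  qed (use R_deriv R_nonneg S_nonneg R_le_1 in auto)
  from tendsto_mult_right[OF this, of "1 / R 0"]
  have lim: "((\<lambda>t. R t * S t * (1 / R 0)) \<longlongrightarrow> 0) at_top" by simp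
  show ?thesis
  proof (rule tendsto_sandwich[OF _ _ tendsto_const lim])
    show "eventually (\<lambda>t. 0 \<le> S t) at_top"
      using eventually_ge_at_top[of 0] by eventually_elim (rule S_nonneg)
    show "eventually (\<lambda>t. S t \<le> R t * S t * (1 / R 0)) at_top"
      using eventually_ge_at_top[of 0]
    proof eventually_elim
      case (elim t)
      then have "R 0 * S t \<le> R t * S t" by (intro mult_right_mono R_ge S_nonneg)
      then show ?case using R0_pos by (simp add: field_simps)
    qed
  qed
qed

lemma q_tendsto_0: "(q \<longlongrightarrow> 0) at_top"
proof -
  have lim: "((\<lambda>t. sqrt (S t)) \<longlongrightarrow> 0) at_top"
    using tendsto_real_sqrt[OF S_tendsto_0] by simp
  have "eventually (\<lambda>t. \<bar>q t\<bar> \<le> sqrt (S t)) at_top"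
    using eventually_ge_at_top[of 0] by eventually_elim (simp add: q_sq_le_S real_le_rsqrt)
  then have "((\<lambda>t. \<bar>q t\<bar>) \<longlongrightarrow> 0) at_top"
    by (intro tendsto_sandwich[OF _ _ tendsto_const lim]) auto
  then show ?thesis by (rule tendsto_rabs_zero_cancel)
qed

text \<open>The drift of \<open>co\<close> is \<open>R * si\<^sup>2 + q * si\<close>. While
  \<open>co\<close> stays away from 1 and -1 the first term is at least \<open>2 * d\<close>, and
  eventually the second is at most \<open>d\<close> in size because \<open>q\<close> vanishes in the
  limit.\<close>

lemma co_dichotomy: "((\<lambda>t. co t x) \<longlongrightarrow> 1) at_top \<or> ((\<lambda>t. co t x) \<longlongrightarrow> -1) at_top"
proof (rule dichotomy_of_drift[where a=0, OF co_deriv])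
  fix k :: real assume k: "0 < k" "k < 1"
  define d where "d = R 0 * (1 - (1 - k)\<^sup>2) / 2"
  have "(1 - k)\<^sup>2 < 1" using k by (simp add: power_less_one_iff abs_square_less_1)
  then have d: "0 < d" using R0_pos by (simp add: d_def)
  have "eventually (\<lambda>t. \<bar>q t\<bar> < d) at_top"
    using tendstoD[OF q_tendsto_0 d] by simp
  then have "eventually (\<lambda>t. \<bar>co t x\<bar> \<le> 1 - k \<longrightarrow> d \<le> (R t * si t x + q t) * si t x) at_top"
    using eventually_ge_at_top[of 0]
  proof eventually_elim
    case (elim t)
    show ?case
    proof
      assume "\<bar>co t x\<bar> \<le> 1 - k"
      then have "(co t x)\<^sup>2 \<le> (1 - k)\<^sup>2" using power_mono[of "\<bar>co t x\<bar>" "1 - k" 2] by simp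
      then have "R 0 * (1 - (1 - k)\<^sup>2) \<le> R t * (si t x)\<^sup>2"
        using elim R_ge[of t] R0_pos \<open>(1 - k)\<^sup>2 < 1\<close> by (intro mult_mono) (auto simp: si_sq)
      then have "2 * d \<le> R t * (si t x)\<^sup>2" by (simp add: d_def)
      moreover have "\<bar>q t * si t x\<bar> \<le> d * 1"
        unfolding abs_mult using elim d by (intro mult_mono abs_si) auto
      ultimately show "d \<le> (R t * si t x + q t) * si t x"
        by (simp add: algebra_simps power2_eq_square abs_le_iff)
    qed
  qed
  then show "\<exists>d>0. eventually (\<lambda>t. \<bar>co t x\<bar> \<le> 1 - k \<longrightarrow> d \<le> (R t * si t x + q t) * si t x) at_top"
    using d by blast
qed (auto simp: abs_co)

lemma si_tendsto_0:
  assumes "((\<lambda>t. co t x) \<longlongrightarrow> c) at_top" "c\<^sup>2 = 1"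
  shows "((\<lambda>t. si t x) \<longlongrightarrow> 0) at_top"
proof -
  have "((\<lambda>t. sqrt (1 - (co t x)\<^sup>2)) \<longlongrightarrow> sqrt (1 - c\<^sup>2)) at_top"
    by (intro tendsto_intros assms)
  then have "((\<lambda>t. \<bar>si t x\<bar>) \<longlongrightarrow> 0) at_top"
    by (simp add: assms flip: si_sq)
  then show ?thesis by (rule tendsto_rabs_zero_cancel)
qed

text \<open>The antipode of the mean phase repels: two distinct characteristics near it separate
  exponentially, so only one of them can stay.\<close>

lemma antipodal_unique:
  assumes x: "((\<lambda>t. co t x) \<longlongrightarrow> -1) at_top" and y: "((\<lambda>t. co t y) \<longlongrightarrow> -1) at_top"
  shows "cos (\<Theta> 0 x - \<Theta> 0 y) = 1"
proof (rule ccontr)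
  assume neq: "cos (\<Theta> 0 x - \<Theta> 0 y) \<noteq> 1"
  \<comment> \<open>One minus the cosine of the angle between the characteristics, written in
    relative phases. It solves the linear equation \<open>D_deriv\<close>, whose growth rate is
    positive once both values of \<open>co\<close> are negative.\<close>
  define D where "D t = 1 - (co t x * co t y + si t x * si t y)" for t
  have D_cos: "D t = 1 - cos (\<Theta> t x - \<Theta> t y)" for t
    using cos_diff[of "\<Theta> t x - \<phi> t" "\<Theta> t y - \<phi> t"] by (simp add: D_def co_def si_def)
  have D_nonneg: "0 \<le> D t" for t by (simp add: D_cos)
  have D_deriv: "(D has_real_derivative - R t * (co t x + co t y) * D t) (at t within {0..})"
    if t: "0 \<le> t" for t
  proof -
    have "(D has_real_derivative
        - ((R t * si t x + q t) * si t x * co t y + (R t * si t y + q t) * si t y * co t x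
           + (- (R t * si t x + q t) * co t x * si t y + - (R t * si t y + q t) * co t y * si t x)))
        (at t within {0..})"
      unfolding D_def
      by (rule DERIV_cong[OF DERIV_diff[OF DERIV_const DERIV_add[OF
              DERIV_mult[OF co_deriv[OF t] co_deriv[OF t]]
              DERIV_mult[OF si_deriv[OF t] si_deriv[OF t]]]]]) simp
    also have "- ((R t * si t x + q t) * si t x * co t y + (R t * si t y + q t) * si t y * co t x
           + (- (R t * si t x + q t) * co t x * si t y + - (R t * si t y + q t) * co t y * si t x))
        = - R t * ((si t x)\<^sup>2 * co t y + (si t y)\<^sup>2 * co t x - si t x * si t y * (co t x + co t y))"
      by (simp add: algebra_simps power2_eq_square)
    also have "\<dots> = - R t * (co t x + co t y) * D t"
      unfolding si_sq D_def by (simp add: algebra_simps power2_eq_square)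
    finally show ?thesis .
  qed
  have D_pos: "0 < D t" if t: "0 \<le> t" for t
  proof -
    \<comment> \<open>As \<open>R\<close> and \<open>\<bar>co\<bar>\<close> are at most 1,
      \<open>D\<close> decays no faster than \<open>exp (- 2 * t)\<close>, so the separation never
      becomes zero.\<close>
    have "exp (2 * 0) * D 0 \<le> exp (2 * t) * D t"
    proof (rule mono_of_deriv_nonneg_halfline[where a=0 and T=0 and f="\<lambda>t. exp (2 * t) * D t"
          and f'="\<lambda>t. exp (2 * t) * D t * (2 - R t * (co t x + co t y))"])
      fix t :: real assume t: "0 \<le> t"
      show "((\<lambda>t. exp (2 * t) * D t) has_real_derivative
          exp (2 * t) * D t * (2 - R t * (co t x + co t y))) (at t within {0..})"
        by (rule derivative_eq_intros D_deriv t refl)+ (simp add: algebra_simps)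
      have "\<bar>R t * co t x\<bar> \<le> 1" "\<bar>R t * co t y\<bar> \<le> 1"
        using R_nonneg[OF t] R_le_1[OF t] by (auto intro!: abs_mult_le_1 abs_co)
      then show "0 \<le> exp (2 * t) * D t * (2 - R t * (co t x + co t y))"
        using D_nonneg by (intro mult_nonneg_nonneg) (auto simp: distrib_left abs_le_iff)
    qed (use t in auto)
    moreover have "0 < D 0" using neq D_nonneg[of 0] by (simp add: D_cos less_le)
    ultimately have "0 < exp (2 * t) * D t" by simp
    then show ?thesis by (simp add: zero_less_mult_iff)
  qed
  have "eventually (\<lambda>t. co t x < 0 \<and> co t y < 0) at_top"
    using order_tendstoD(2)[OF x, of 0] order_tendstoD(2)[OF y, of 0] by (simp add: eventually_conj)
  then obtain T where T: "\<And>t. T \<le> t \<Longrightarrow> co t x < 0 \<and> co t y < 0"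
    by (auto simp: eventually_at_top_linorder)
  define T' where "T' = max 0 T"
  have "D T' \<le> D t" if t: "T' \<le> t" for t
  proof (rule mono_of_deriv_nonneg_halfline[OF D_deriv, where T=T'])
    fix t assume "T' \<le> t"
    then show "0 \<le> - R t * (co t x + co t y) * D t"
      using T[of t] R_nonneg[of t] D_nonneg[of t]
      by (intro mult_nonneg_nonneg[OF mult_nonpos_nonpos]) (auto simp: T'_def)
  qed (use t in \<open>auto simp: T'_def\<close>)
  then have "eventually (\<lambda>t. D T' \<le> D t) at_top"
    by (auto simp: eventually_at_top_linorder)
  moreover have "(D \<longlongrightarrow> 1 - (-1 * -1 + 0 * 0)) at_top"
    unfolding D_def by (intro tendsto_intros x y si_tendsto_0[OF x] si_tendsto_0[OF y]) auto
  ultimately have "D T' \<le> 0"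
    using tendsto_lowerbound[of D 0 at_top "D T'"] by simp
  then show False using D_pos[of T'] by (simp add: T'_def)
qed

section \<open>Convergence of the mean phase\<close>

lemma co_bounds: "-1 \<le> co t x" "co t x \<le> 1"
  using abs_co[of t x] by (auto simp: abs_le_iff)

abbreviation rest :: "'a set \<Rightarrow> 'a \<Rightarrow> real" where "rest P \<equiv> indicator (space M - P)"

text \<open>In the half angle, \<open>sqrt (1 - co)\<close> and \<open>sqrt (1 + co)\<close> are
  \<open>sqrt 2\<close> times the absolute sine and cosine of half the relative phase.
  \<open>E\<close> bounds the part of \<open>q\<close> coming from outside \<open>P\<close>,
  \<open>N\<close> is the coefficient of the error in the growth of \<open>U\<close>, and
  \<open>e\<close> removes the singularity of the root at the antipode.\<close>

definition E where "E P t = (\<integral>x. rest P x * (\<bar>si t x\<bar> * (1 - co t x)) \<partial>M)"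
definition N where "N P t = (\<integral>x. rest P x * sqrt (1 - co t x) \<partial>M)"
definition U where "U P e t = (\<integral>x. rest P x * (2 * sqrt (1 + co t x + e\<^sup>2)) \<partial>M)"

context
  fixes P :: "'a set"
  assumes P: "P \<in> sets M"
    and P_lim: "AE x in M. x \<notin> P \<longrightarrow> ((\<lambda>t. co t x) \<longlongrightarrow> 1) at_top"
begin

lemma rest_measurable [measurable]: "rest P \<in> borel_measurable M"
  using P by measurable

lemma abs_rest_mult: "\<bar>y\<bar> \<le> B \<Longrightarrow> \<bar>rest P x * y\<bar> \<le> B"
  by (auto simp: indicator_def)

lemma integrable_E: "0 \<le> t \<Longrightarrow> integrable M (\<lambda>x. rest P x * (\<bar>si t x\<bar> * (1 - co t x)))"
proof (rule integrable_bounded)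
  fix x
  have "\<bar>si t x\<bar> * (1 - co t x) \<le> 1 * 2"
    using co_bounds[of t x] by (intro mult_mono abs_si) auto
  then show "\<bar>rest P x * (\<bar>si t x\<bar> * (1 - co t x))\<bar> \<le> 2"
    using co_bounds[of t x] by (intro abs_rest_mult) (simp add: abs_mult)
qed measurable

lemma integrable_N: "0 \<le> t \<Longrightarrow> integrable M (\<lambda>x. rest P x * sqrt (1 - co t x))"
proof (rule integrable_bounded)
  fix x
  show "\<bar>rest P x * sqrt (1 - co t x)\<bar> \<le> 2"
    using co_bounds[of t x] by (intro abs_rest_mult abs_sqrt_le) auto
qed measurable

lemma E_nonneg: "0 \<le> E P t"
  unfolding E_def by (intro Bochner_Integration.integral_nonneg mult_nonneg_nonneg) (auto simp: co_bounds)

lemma N_tendsto_0: "(N P \<longlongrightarrow> 0) at_top"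
proof -
  have "(N P \<longlongrightarrow> (\<integral>x. 0 \<partial>M)) at_top"
    unfolding N_def
  proof (rule tendsto_integral_bounded_at_top[where B=2])
    fix t :: real and x assume "0 \<le> t"
    show "\<bar>rest P x * sqrt (1 - co t x)\<bar> \<le> 2"
      using co_bounds[of t x] by (intro abs_rest_mult abs_sqrt_le) auto
  next
    show "AE x in M. ((\<lambda>t. rest P x * sqrt (1 - co t x)) \<longlongrightarrow> 0) at_top"
      using P_lim
    proof eventually_elim
      case (elim x)
      show ?case
      proof (cases "x \<in> P")
        case False
        then have "((\<lambda>t. rest P x * sqrt (1 - co t x)) \<longlongrightarrow> rest P x * sqrt (1 - 1)) at_top"
          using elim by (intro tendsto_intros) auto
        then show ?thesis by simp
      qed simp
    qed
  qed auto
  then show ?thesis by simp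
qed

lemma U_bounds: "0 \<le> t \<Longrightarrow> \<bar>e\<bar> \<le> 1 \<Longrightarrow> \<bar>U P e t\<bar> \<le> 4"
  unfolding U_def
proof (rule integral_bounded_le)
  fix x
  assume "\<bar>e\<bar> \<le> 1"
  then have "e\<^sup>2 \<le> 1" by (simp add: abs_square_le_1)
  then have "\<bar>sqrt (1 + co t x + e\<^sup>2)\<bar> \<le> 2"
    using co_bounds[of t x] by (intro abs_sqrt_le) auto
  then show "\<bar>rest P x * (2 * sqrt (1 + co t x + e\<^sup>2))\<bar> \<le> 4"
    by (intro abs_rest_mult) (simp add: abs_mult)
qed measurable

lemma U_smoothing:
  assumes t: "0 \<le> t" and e: "0 < e" "e < 1"
  shows "\<bar>U P e t - U P 0 t\<bar> \<le> 2 * e"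
proof -
  have int: "integrable M (\<lambda>x. rest P x * (2 * sqrt (1 + co t x + d\<^sup>2)))" if "\<bar>d\<bar> \<le> 1" for d
  proof (rule integrable_bounded)
    fix x
    have "d\<^sup>2 \<le> 1" using that by (simp add: abs_square_le_1)
    then have "\<bar>sqrt (1 + co t x + d\<^sup>2)\<bar> \<le> 2"
      using co_bounds[of t x] by (intro abs_sqrt_le) auto
    then show "\<bar>rest P x * (2 * sqrt (1 + co t x + d\<^sup>2))\<bar> \<le> 4"
      by (intro abs_rest_mult) (simp add: abs_mult)
  qed (use t in measurable)
  have "U P e t - U P 0 t = (\<integral>x. rest P x * (2 * sqrt (1 + co t x + e\<^sup>2))
      - rest P x * (2 * sqrt (1 + co t x + 0\<^sup>2)) \<partial>M)"
    unfolding U_def using int[of e] int[of 0] e by (subst Bochner_Integration.integral_diff) auto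
  also have "\<bar>\<dots>\<bar> \<le> 2 * e"
  proof (rule integral_bounded_le)
    fix x
    have "sqrt (1 + co t x) \<le> sqrt (1 + co t x + e\<^sup>2)" by simp
    moreover have "sqrt (1 + co t x + e\<^sup>2) \<le> sqrt (1 + co t x) + e"
      using sqrt_add_le_add_sqrt[of "1 + co t x" "e\<^sup>2"] co_bounds[of t x] e by simp
    ultimately show "\<bar>rest P x * (2 * sqrt (1 + co t x + e\<^sup>2)) - rest P x * (2 * sqrt (1 + co t x + 0\<^sup>2))\<bar> \<le> 2 * e"
      unfolding right_diff_distrib[symmetric] by (intro abs_rest_mult) auto
  qed (use t in measurable)
  finally show ?thesis .
qed

text \<open>For positive \<open>e\<close> the differentiated integrand is bounded by
  \<open>2 / e\<close> uniformly in time, which permits differentiation under the integral. The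
  lower bound is \<open>smoothed_drift_bound\<close> averaged outside \<open>P\<close>.\<close>

lemma U_deriv:
  assumes t: "0 \<le> t" and e: "0 < e" "e < 1"
  shows "\<exists>D. (U P e has_real_derivative D) (at t within {0..}) \<and>
    R t / 2 * E P t - 2 * e - \<bar>q t\<bar> * N P t \<le> D"
proof (intro exI conjI)
  let ?D = "\<lambda>t x. rest P x * (si t x * (R t * si t x + q t) / sqrt (1 + co t x + e\<^sup>2))"
  have pos: "e\<^sup>2 \<le> 1 + co t x + e\<^sup>2" for t x using co_bounds[of t x] by simp
  have bound: "\<bar>?D t x\<bar> \<le> 2 / e" if t: "0 \<le> t" for t x
  proof (rule abs_rest_mult)
    have "e \<le> sqrt (1 + co t x + e\<^sup>2)" using pos by (rule real_le_rsqrt)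
    moreover have "\<bar>si t x\<bar> * \<bar>R t * si t x + q t\<bar> \<le> 1 * 2"
      by (intro mult_mono abs_si abs_drift t) auto
    ultimately show "\<bar>si t x * (R t * si t x + q t) / sqrt (1 + co t x + e\<^sup>2)\<bar> \<le> 2 / e"
      using e by (simp add: abs_mult) (intro frac_le; simp)
  qed
  show "(U P e has_real_derivative (\<integral>x. ?D t x \<partial>M)) (at t within {0..})"
    unfolding U_def
  proof (rule has_real_derivative_integral[where C=4 and B="2 / e"])
    fix t :: real and x assume t: "0 \<le> t"
    show "(\<lambda>x. rest P x * (2 * sqrt (1 + co t x + e\<^sup>2))) \<in> borel_measurable M"
      using t by measurable
    have "e\<^sup>2 \<le> 1" using e by (simp add: abs_square_le_1)
    then have "\<bar>sqrt (1 + co t x + e\<^sup>2)\<bar> \<le> 2"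
      using co_bounds[of t x] by (intro abs_sqrt_le) auto
    then show "\<bar>rest P x * (2 * sqrt (1 + co t x + e\<^sup>2))\<bar> \<le> 4"
      by (intro abs_rest_mult) (simp add: abs_mult)
    have "0 < 1 + co t x + e\<^sup>2" using pos[of t x] e by (smt (verit) zero_less_power)
    then show "((\<lambda>t. rest P x * (2 * sqrt (1 + co t x + e\<^sup>2))) has_real_derivative ?D t x)
        (at t within {0..})"
      by (auto intro!: derivative_eq_intros co_deriv t simp: field_simps)
  qed (use bound t in auto)
  have meas: "?D t \<in> borel_measurable M" using t by measurable
  have "R t / 2 * E P t - 2 * e - \<bar>q t\<bar> * N P t
      = (\<integral>x. R t / 2 * (rest P x * (\<bar>si t x\<bar> * (1 - co t x))) - 2 * e
          - \<bar>q t\<bar> * (rest P x * sqrt (1 - co t x)) \<partial>M)"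
    using integrable_E[OF t] integrable_N[OF t] by (simp add: E_def N_def prob_space)
  also have "\<dots> \<le> (\<integral>x. ?D t x \<partial>M)"
  proof (rule integral_mono)
    show "integrable M (\<lambda>x. R t / 2 * (rest P x * (\<bar>si t x\<bar> * (1 - co t x))) - 2 * e
          - \<bar>q t\<bar> * (rest P x * sqrt (1 - co t x)))"
      using integrable_E[OF t] integrable_N[OF t] by simp
    show "integrable M (?D t)" using meas bound[OF t] by (rule integrable_bounded)
    fix x
    show "R t / 2 * (rest P x * (\<bar>si t x\<bar> * (1 - co t x))) - 2 * e
          - \<bar>q t\<bar> * (rest P x * sqrt (1 - co t x)) \<le> ?D t x"
      using smoothed_drift_bound[OF si_sq[of t x] abs_co e(1) R_nonneg[OF t] R_le_1[OF t], of "q t"] e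
      by (auto simp: indicator_def)
  qed
  finally show "R t / 2 * E P t - 2 * e - \<bar>q t\<bar> * N P t \<le> (\<integral>x. ?D t x \<partial>M)" .
qed

text \<open>The antipodal mass enters only through \<open>W\<close>. The weights \<open>12 / R 0\<close> and \<open>4\<close> make the total
  increase of the combination of \<open>U\<close> and \<open>W\<close> control that of every \<open>h\<close> moving at most as fast as
  the phase; the parameter \<open>e\<close> smooths the square roots where they vanish.\<close>

lemma convergent_of_lyapunov:
  fixes a h k :: "real \<Rightarrow> real" and W :: "real \<Rightarrow> real \<Rightarrow> real"
  assumes "0 \<le> \<tau>"
    and q_le: "\<And>t. \<tau> \<le> t \<Longrightarrow> \<bar>q t\<bar> \<le> 2 * a t + E P t"
    and W_deriv: "\<And>e t. 0 < e \<Longrightarrow> e < 1 \<Longrightarrow> \<tau> \<le> t \<Longrightarrow>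
      \<exists>D. (W e has_real_derivative D) (at t within {0..}) \<and> 3 / 4 * a t - E P t - e \<le> D"
    and W_smoothing: "\<And>e t. 0 < e \<Longrightarrow> e < 1 \<Longrightarrow> \<tau> \<le> t \<Longrightarrow> \<bar>W e t - W 0 t\<bar> \<le> e"
    and W_bound: "\<And>t. \<tau> \<le> t \<Longrightarrow> W 0 t \<le> 1"
    and h: "\<And>t. 0 \<le> t \<Longrightarrow> (h has_real_derivative k t) (at t within {0..})"
    and k: "\<And>t. 0 \<le> t \<Longrightarrow> \<bar>k t\<bar> \<le> \<bar>q t\<bar>"
  shows "\<exists>l. (h \<longlongrightarrow> l) at_top"
proof -
  define A where "A = 12 / R 0"
  have A: "0 < A" using R0_pos by (simp add: A_def)
  \<comment> \<open>Total smoothing cost per unit of \<open>e\<close>: \<open>2 * A\<close> from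
    \<open>U\<close> and 4 from \<open>W\<close>.\<close>
  define K where "K = 2 * A + 4"
  \<comment> \<open>After this time the \<open>N\<close> term, weighted by \<open>A\<close>, costs
    at most half of \<open>\<bar>q\<bar>\<close>.\<close>
  have "eventually (\<lambda>t. N P t < 1 / (2 * A)) at_top"
    using order_tendstoD(2)[OF N_tendsto_0] A by simp
  then obtain T1 where T1: "\<And>t. T1 \<le> t \<Longrightarrow> N P t < 1 / (2 * A)"
    by (auto simp: eventually_at_top_linorder)
  define T where "T = max \<tau> T1"
  define L where "L e t = A * U P e t + 4 * W e t" for e t
  have L_deriv: "\<exists>D. (L e has_real_derivative D) (at t within {0..}) \<and> \<bar>q t\<bar> - K * e \<le> D"
    if e: "0 < e" "e < 1" and t: "T \<le> t" for e t
  proof -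
    have t0: "0 \<le> t" "\<tau> \<le> t" "T1 \<le> t" using t \<open>0 \<le> \<tau>\<close> by (auto simp: T_def)
    obtain D1 where D1: "(U P e has_real_derivative D1) (at t within {0..})"
      "R t / 2 * E P t - 2 * e - \<bar>q t\<bar> * N P t \<le> D1"
      using U_deriv[OF t0(1) e] by blast
    obtain D2 where D2: "(W e has_real_derivative D2) (at t within {0..})"
      "3 / 4 * a t - E P t - e \<le> D2"
      using W_deriv[OF e t0(2)] by blast
    have "R 0 / 2 * E P t \<le> R t / 2 * E P t"
      using R_ge[OF t0(1)] E_nonneg by (intro mult_right_mono) auto
    then have "A * (R 0 / 2 * E P t - 2 * e - \<bar>q t\<bar> * N P t) \<le> A * D1"
      using D1(2) A by (intro mult_left_mono) auto
    moreover have "A * (R 0 / 2 * E P t) = 6 * E P t" using R0_pos by (simp add: A_def)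
    moreover have "\<bar>q t\<bar> * (A * N P t) \<le> \<bar>q t\<bar> * (1 / 2)"
      using T1[OF t0(3)] A by (intro mult_left_mono) (auto simp: field_simps)
    moreover have "A * (R 0 / 2 * E P t - 2 * e - \<bar>q t\<bar> * N P t)
        = A * (R 0 / 2 * E P t) - 2 * A * e - \<bar>q t\<bar> * (A * N P t)"
      by (simp add: right_diff_distrib ac_simps)
    ultimately have "6 * E P t - 2 * A * e - \<bar>q t\<bar> / 2 \<le> A * D1" by linarith
    moreover have "0 \<le> E P t" by (rule E_nonneg)
    \<comment> \<open>Of \<open>6 * E\<close> from \<open>U\<close>, \<open>4 * E\<close> pays for
      the loss in \<open>W\<close>. The remaining \<open>2 * E + 3 * a\<close> is at least
      \<open>3 / 2 * \<bar>q\<bar>\<close>, so \<open>\<bar>q\<bar>\<close> is left after the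
      \<open>N\<close> term.\<close>
    ultimately have "\<bar>q t\<bar> - K * e \<le> A * D1 + 4 * D2"
      using D2(2) q_le[OF t0(2)] by (simp add: K_def algebra_simps)
    moreover have "(L e has_real_derivative A * D1 + 4 * D2) (at t within {0..})"
      unfolding L_def by (auto intro!: derivative_eq_intros D1(1) D2(1))
    ultimately show ?thesis by blast
  qed
  have smooth: "\<bar>L e t - L 0 t\<bar> \<le> K * e" if e: "0 < e" "e < 1" and t: "T \<le> t" for e t
  proof -
    have "\<bar>A * (U P e t - U P 0 t)\<bar> \<le> A * (2 * e)"
      unfolding abs_mult using A U_smoothing[OF _ e, of t] t \<open>0 \<le> \<tau>\<close>
      by (intro mult_mono) (auto simp: T_def)
    moreover have "\<bar>W e t - W 0 t\<bar> \<le> e" using W_smoothing[OF e, of t] t by (auto simp: T_def)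
    ultimately show ?thesis by (simp add: L_def K_def algebra_simps abs_le_iff)
  qed
  have inc: "g * (h t - h s) \<le> L 0 t - L 0 s"
    if g: "\<bar>g\<bar> = 1" and s: "T \<le> s" "s \<le> t" for g s t
  proof (rule field_le_epsilon)
    fix r :: real assume r: "0 < r"
    \<comment> \<open>The errors on the interval add up to \<open>K * e\<close> at each endpoint and
      \<open>K * e * (t - s)\<close> from the derivative, which this choice keeps below
      \<open>r\<close>. The bound \<open>1/2\<close> ensures \<open>e < 1\<close>.\<close>
    define e where "e = min (1/2) (r / (K * (t - s + 2)))"
    have Kpos: "0 < K * (t - s + 2)" using A s by (simp add: K_def)
    have e: "0 < e" "e < 1" using r Kpos by (auto simp: e_def)
    have "\<forall>t. \<exists>D. T \<le> t \<longrightarrow> (L e has_real_derivative D) (at t within {0..}) \<and> \<bar>q t\<bar> - K * e \<le> D"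
      using L_deriv[OF e] by blast
    then obtain D where D: "\<And>t. T \<le> t \<Longrightarrow> (L e has_real_derivative D t) (at t within {0..})"
      "\<And>t. T \<le> t \<Longrightarrow> \<bar>q t\<bar> - K * e \<le> D t" by metis
    have "L e s - g * h s + K * e * s \<le> L e t - g * h t + K * e * t"
    proof (rule mono_of_deriv_nonneg_halfline[where a=T and T=T and
          f="\<lambda>t. L e t - g * h t + K * e * t" and f'="\<lambda>t. D t - g * k t + K * e"])
      fix t assume t: "T \<le> t"
      have T: "0 \<le> T" using \<open>0 \<le> \<tau>\<close> by (simp add: T_def)
      have "((\<lambda>t. L e t - g * h t + K * e * t) has_real_derivative D t - g * k t + K * e)
          (at t within {0..})"
        by (rule derivative_eq_intros D(1) h refl t order_trans[OF T t])+ simp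
      then show "((\<lambda>t. L e t - g * h t + K * e * t) has_real_derivative D t - g * k t + K * e)
          (at t within {T..})"
        by (rule DERIV_subset) (use T in auto)
      have "\<bar>g * k t\<bar> \<le> \<bar>q t\<bar>" using g k[of t] t T by (simp add: abs_mult)
      then show "0 \<le> D t - g * k t + K * e" using D(2)[OF t] by (auto simp: abs_le_iff)
    qed (use s in auto)
    moreover have "\<bar>L e t - L 0 t\<bar> \<le> K * e" "\<bar>L e s - L 0 s\<bar> \<le> K * e"
      using smooth e s by auto
    ultimately have "g * (h t - h s) \<le> L 0 t - L 0 s + K * (t - s + 2) * e"
      by (simp add: algebra_simps abs_le_iff)
    also have "K * (t - s + 2) * e \<le> K * (t - s + 2) * (r / (K * (t - s + 2)))"
      using Kpos by (intro mult_left_mono) (auto simp: e_def)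
    also have "\<dots> = r"
      using less_imp_neq[OF Kpos] by (metis nonzero_mult_div_cancel_left times_divide_eq_right)
    finally show "g * (h t - h s) \<le> L 0 t - L 0 s + r" by simp
  qed
  show ?thesis
  proof (rule convergent_of_dist_le_increment[where T=T and L="L 0" and B="A * 4 + 4"])
    fix s t assume "T \<le> s" "s \<le> t"
    then show "\<bar>h t - h s\<bar> \<le> L 0 t - L 0 s"
      using inc[of 1 s t] inc[of "-1" s t] by (simp add: abs_le_iff)
  next
    fix t assume t: "T \<le> t"
    have "A * U P 0 t \<le> A * 4"
      using A U_bounds[of t 0] t \<open>0 \<le> \<tau>\<close> by (intro mult_left_mono) (auto simp: T_def abs_le_iff)
    then show "L 0 t \<le> A * 4 + 4" using W_bound[of t] t by (simp add: L_def T_def)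
  qed
qed

end

text \<open>\<open>R\<close> is the mean of \<open>co\<close>, whose limit is -1 on \<open>P\<close>
  and 1 almost everywhere else; dominated convergence applies.\<close>

lemma R_tendsto:
  assumes P: "P \<in> sets M"
    and out: "AE x in M. x \<notin> P \<longrightarrow> ((\<lambda>t. co t x) \<longlongrightarrow> 1) at_top"
    and ins: "\<And>x. x \<in> P \<Longrightarrow> ((\<lambda>t. co t x) \<longlongrightarrow> -1) at_top"
  shows "(R \<longlongrightarrow> 1 - 2 * prob P) at_top"
proof -
  have "((\<lambda>t. \<integral>x. co t x \<partial>M) \<longlongrightarrow> (\<integral>x. 1 - 2 * indicator P x \<partial>M)) at_top"
  proof (rule tendsto_integral_bounded_at_top[OF _ abs_co])
    show "AE x in M. ((\<lambda>t. co t x) \<longlongrightarrow> 1 - 2 * indicator P x) at_top"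
      using out by eventually_elim (auto simp: indicator_def ins)
  qed (use P in auto)
  also have "(\<integral>x. 1 - 2 * indicator P x \<partial>M) = 1 - 2 * prob P"
    using P by (simp add: prob_space less_top[symmetric])
  finally have "((\<lambda>t. \<integral>x. co t x \<partial>M) \<longlongrightarrow> 1 - 2 * prob P) at_top" .
  moreover have "eventually (\<lambda>t. (\<integral>x. co t x \<partial>M) = R t) at_top"
    using eventually_ge_at_top[of 0] by eventually_elim (rule integral_co)
  ultimately show ?thesis by (rule Lim_transform_eventually)
qed

text \<open>The mean of \<open>si\<close> vanishes, so \<open>si * co\<close> may be replaced by \<open>- si * (1 - co)\<close>, which is of
  third order near the mean phase.\<close>

lemma q_split:
  assumes P: "P \<in> sets M" and t: "0 \<le> t"
  shows "\<bar>q t - (\<integral>x. indicator P x * (si t x * (1 - co t x)) \<partial>M)\<bar> \<le> E P t"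
proof -
  define F where "F x = si t x * (1 - co t x)" for x
  have F: "\<bar>F x\<bar> = \<bar>si t x\<bar> * (1 - co t x)" for x
    using co_bounds[of t x] by (simp add: F_def abs_mult)
  have F_le: "\<bar>F x\<bar> \<le> 2" for x
    using mult_mono[OF abs_si, of "1 - co t x" 2 t x] co_bounds[of t x] by (simp add: F)
  have meas: "F \<in> borel_measurable M" unfolding F_def using t by measurable
  have int: "integrable M (\<lambda>x. indicator A x * F x)" if "A \<in> sets M" for A
    using meas that F_le by (intro integrable_bounded[where B=2]) (auto simp: indicator_def)
  have "q t = (\<integral>x. F x \<partial>M)"
    using integrable_trig[OF t] integral_si[OF t] by (simp add: q_def F_def right_diff_distrib)
  also have "\<dots> = (\<integral>x. indicator P x * F x + indicator (space M - P) x * F x \<partial>M)"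
    by (intro Bochner_Integration.integral_cong) (auto simp: indicator_def)
  also have "\<dots> = (\<integral>x. indicator P x * F x \<partial>M) + (\<integral>x. indicator (space M - P) x * F x \<partial>M)"
    using P by (intro Bochner_Integration.integral_add int) auto
  finally have "\<bar>q t - (\<integral>x. indicator P x * F x \<partial>M)\<bar>
      = \<bar>\<integral>x. indicator (space M - P) x * F x \<partial>M\<bar>" by simp
  also have "\<dots> \<le> (\<integral>x. \<bar>indicator (space M - P) x * F x\<bar> \<partial>M)" by (rule integral_abs_bound)
  also have "\<dots> = E P t"
    using P unfolding E_def by (simp add: abs_mult F)
  finally show ?thesis by (simp add: F_def)
qed

text \<open>Supplies \<open>W\<close> for \<open>convergent_of_lyapunov\<close>: zero if no point
  stays antipodal, otherwise the mass of \<open>p\<close> times the smoothed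
  \<open>\<bar>si t p\<bar>\<close>, which grows because the antipode repels.\<close>

lemma convergent_of_rate_le_q:
  assumes P: "P \<in> sets M"
    and out: "AE x in M. x \<notin> P \<longrightarrow> ((\<lambda>t. co t x) \<longlongrightarrow> 1) at_top"
    and P_cases: "P = {} \<or> (\<exists>p. P = {p} \<and> ((\<lambda>t. co t p) \<longlongrightarrow> -1) at_top)"
    and h: "\<And>t. 0 \<le> t \<Longrightarrow> (h has_real_derivative k t) (at t within {0..})"
    and k: "\<And>t. 0 \<le> t \<Longrightarrow> \<bar>k t\<bar> \<le> \<bar>q t\<bar>"
  shows "\<exists>l. (h \<longlongrightarrow> l) at_top"
  using P_cases
proof
  assume "P = {}"
  show ?thesis
  proof (rule convergent_of_lyapunov[OF P out, where h=h and k=k and \<tau>=0 and a="\<lambda>_. 0" and W="\<lambda>_ _. 0"])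
    fix t :: real assume "0 \<le> t"
    then show "\<bar>q t\<bar> \<le> 2 * 0 + E P t" using q_split[OF P, of t] \<open>P = {}\<close> by simp
  next
    fix e t :: real assume "0 < e"
    then show "\<exists>D. ((\<lambda>_. 0) has_real_derivative D) (at t within {0..}) \<and> 3 / 4 * 0 - E P t - e \<le> D"
      using E_nonneg[OF P out, of t] by (intro exI[of _ 0]) auto
  qed (simp_all add: h k)
next
  assume "\<exists>p. P = {p} \<and> ((\<lambda>t. co t p) \<longlongrightarrow> -1) at_top"
  then obtain p where p: "P = {p}" "((\<lambda>t. co t p) \<longlongrightarrow> -1) at_top" by blast
  define m where "m = prob P"
  have m: "0 \<le> m" "m \<le> 1" by (auto simp: m_def)
  have q_split_p: "\<bar>q t - m * (si t p * (1 - co t p))\<bar> \<le> E P t" if "0 \<le> t" for t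
  proof -
    have "(\<integral>x. indicator P x * (si t x * (1 - co t x)) \<partial>M)
        = (\<integral>x. indicator P x * (si t p * (1 - co t p)) \<partial>M)"
      by (intro Bochner_Integration.integral_cong) (auto simp: indicator_def p)
    also have "\<dots> = m * (si t p * (1 - co t p))"
      using P by (simp add: m_def less_top[symmetric])
    finally show ?thesis using q_split[OF P that] by simp
  qed
  have "(R \<longlongrightarrow> 1 - 2 * m) at_top"
    unfolding m_def by (rule R_tendsto[OF P out]) (use p in auto)
  \<comment> \<open>This is the growth rate of \<open>si t p\<close>, including the effect of the
    mass at \<open>p\<close> on the mean phase. Its limit is 1 whatever \<open>m\<close> is, because
    the \<open>m\<close> terms cancel; 3/4 is a convenient smaller value.\<close>
  then have "((\<lambda>t. - co t p * (R t + m * (1 - co t p))) \<longlongrightarrow>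
      - (-1) * ((1 - 2 * m) + m * (1 - (-1)))) at_top"
    by (intro tendsto_intros p)
  then have "eventually (\<lambda>t. 3 / 4 < - co t p * (R t + m * (1 - co t p))) at_top"
    by (rule order_tendstoD(1)) simp
  then obtain T1 where T1: "\<And>t. T1 \<le> t \<Longrightarrow> 3 / 4 < - co t p * (R t + m * (1 - co t p))"
    by (auto simp: eventually_at_top_linorder)
  show ?thesis
  proof (rule convergent_of_lyapunov[OF P out, where h=h and k=k and \<tau>="max 0 T1" and a="\<lambda>t. m * \<bar>si t p\<bar>"
        and W="\<lambda>e t. m * sqrt ((si t p)\<^sup>2 + e\<^sup>2)"])
    fix t assume "max 0 T1 \<le> t"
    then have t: "0 \<le> t" by simp
    have "\<bar>m * (si t p * (1 - co t p))\<bar> \<le> m * (\<bar>si t p\<bar> * 2)"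
      unfolding abs_mult using m co_bounds[of t p] by (intro mult_mono) auto
    then show "\<bar>q t\<bar> \<le> 2 * (m * \<bar>si t p\<bar>) + E P t"
      using q_split_p[OF t] by linarith
    show "m * sqrt ((si t p)\<^sup>2 + 0\<^sup>2) \<le> 1"
      using mult_le_one[OF m(2) _ abs_si] by simp
  next
    fix e t :: real assume e: "0 < e" "e < 1" and t: "max 0 T1 \<le> t"
    have sq: "\<bar>sqrt ((si t p)\<^sup>2 + e\<^sup>2) - \<bar>si t p\<bar>\<bar> \<le> e"
      using sqrt_add_le_add_sqrt[of "(si t p)\<^sup>2" "e\<^sup>2"] real_sqrt_le_mono[of "(si t p)\<^sup>2" "(si t p)\<^sup>2 + e\<^sup>2"] e
      by simp
    have "\<bar>m * (sqrt ((si t p)\<^sup>2 + e\<^sup>2) - \<bar>si t p\<bar>)\<bar> \<le> 1 * e"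
      unfolding abs_mult[of m] using m sq by (intro mult_mono) auto
    then show "\<bar>m * sqrt ((si t p)\<^sup>2 + e\<^sup>2) - m * sqrt ((si t p)\<^sup>2 + 0\<^sup>2)\<bar> \<le> e"
      by (simp add: right_diff_distrib)
  next
    fix e t :: real assume e: "0 < e" "e < 1" and t: "max 0 T1 \<le> t"
    have t0: "0 \<le> t" "T1 \<le> t" using t by auto
    define w where "w = sqrt ((si t p)\<^sup>2 + e\<^sup>2)"
    \<comment> \<open>\<open>r\<close> is the part of \<open>q\<close> not caused by
      \<open>p\<close>, bounded by \<open>E\<close>. The part caused by \<open>p\<close> is
      proportional to \<open>si t p\<close> and is absorbed into the rate \<open>g\<close>.\<close>
    define r where "r = q t - m * (si t p * (1 - co t p))"
    define g where "g = - co t p * (R t + m * (1 - co t p))"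
    have pos: "0 < (si t p)\<^sup>2 + e\<^sup>2" using e by (simp add: add_nonneg_pos)
    then have w: "0 < w" by (simp add: w_def)
    have sw: "\<bar>si t p\<bar> \<le> w" unfolding w_def by (rule real_le_rsqrt) simp
    have deriv: "((\<lambda>t. m * sqrt ((si t p)\<^sup>2 + e\<^sup>2)) has_real_derivative
        m * (si t p * (- (R t * si t p + q t) * co t p) / w)) (at t within {0..})"
      unfolding w_def by (rule DERIV_cmult[OF smoothed_abs_deriv[OF si_deriv[OF t0(1)] e(1)]])
    have "si t p * (- (R t * si t p + q t) * co t p) = g * (si t p)\<^sup>2 - co t p * r * si t p"
      by (simp add: g_def r_def algebra_simps power2_eq_square)
    then have eq: "si t p * (- (R t * si t p + q t) * co t p) / w
        = g * ((si t p)\<^sup>2 / w) - co t p * r * (si t p / w)"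
      by (simp add: diff_divide_distrib)
    have "3 / 4 * (\<bar>si t p\<bar> - e) \<le> 3 / 4 * ((si t p)\<^sup>2 / w)"
      using smoothed_abs_ge[OF e(1), of "si t p"] by (simp add: w_def)
    also have "\<dots> \<le> g * ((si t p)\<^sup>2 / w)"
      using T1[OF t0(2)] w by (intro mult_right_mono) (auto simp: g_def)
    finally have 1: "3 / 4 * (\<bar>si t p\<bar> - e) \<le> g * ((si t p)\<^sup>2 / w)" .
    have "\<bar>co t p * (si t p / w)\<bar> \<le> 1"
      using w sw by (intro abs_mult_le_1 abs_co) simp
    then have "\<bar>co t p * (si t p / w)\<bar> * \<bar>r\<bar> \<le> 1 * E P t"
      using q_split_p[OF t0(1)] unfolding r_def by (rule mult_mono) simp_all
    then have "\<bar>co t p * r * (si t p / w)\<bar> \<le> E P t"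
      unfolding abs_mult[symmetric] by (simp only: ac_simps)
    then have "3 / 4 * \<bar>si t p\<bar> - e - E P t \<le> si t p * (- (R t * si t p + q t) * co t p) / w"
      using 1 e(1) unfolding eq abs_le_iff right_diff_distrib by linarith
    then have "m * (3 / 4 * \<bar>si t p\<bar> - e - E P t)
        \<le> m * (si t p * (- (R t * si t p + q t) * co t p) / w)"
      using m by (intro mult_left_mono)
    moreover have "m * e \<le> e" using m e by (intro mult_left_le_one_le) simp_all
    moreover have "m * E P t \<le> E P t" using m E_nonneg[OF P out, of t] by (intro mult_left_le_one_le)
    ultimately have "3 / 4 * (m * \<bar>si t p\<bar>) - E P t - e
        \<le> m * (si t p * (- (R t * si t p + q t) * co t p) / w)"
      by (simp add: algebra_simps)
    with deriv show "\<exists>D. ((\<lambda>t. m * sqrt ((si t p)\<^sup>2 + e\<^sup>2)) has_real_derivative D) (at t within {0..})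
        \<and> 3 / 4 * (m * \<bar>si t p\<bar>) - E P t - e \<le> D" by (intro exI conjI)
  qed (simp_all add: h k)
qed

text \<open>Both \<open>cos \<phi>\<close> and \<open>sin \<phi>\<close> change at rate at most
  \<open>\<bar>q\<bar>\<close>, so both converge; their limits still satisfy the equation of the
  unit circle and hence come from an angle.\<close>

lemma phase_convergent:
  assumes P: "P \<in> sets M"
    and out: "AE x in M. x \<notin> P \<longrightarrow> ((\<lambda>t. co t x) \<longlongrightarrow> 1) at_top"
    and P_cases: "P = {} \<or> (\<exists>p. P = {p} \<and> ((\<lambda>t. co t p) \<longlongrightarrow> -1) at_top)"
  obtains \<phi>s where "((\<lambda>t. cos (\<phi> t)) \<longlongrightarrow> cos \<phi>s) at_top" "((\<lambda>t. sin (\<phi> t)) \<longlongrightarrow> sin \<phi>s) at_top"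
proof -
  have "\<exists>l. ((\<lambda>t. cos (\<phi> t)) \<longlongrightarrow> l) at_top"
    by (rule convergent_of_rate_le_q[OF assms cos_phase_deriv])
      (auto simp: abs_mult intro: mult_left_le)
  then obtain a where a: "((\<lambda>t. cos (\<phi> t)) \<longlongrightarrow> a) at_top" by blast
  have "\<exists>l. ((\<lambda>t. sin (\<phi> t)) \<longlongrightarrow> l) at_top"
    by (rule convergent_of_rate_le_q[OF assms sin_phase_deriv])
      (auto simp: abs_mult intro: mult_left_le)
  then obtain b where b: "((\<lambda>t. sin (\<phi> t)) \<longlongrightarrow> b) at_top" by blast
  have "((\<lambda>t. (cos (\<phi> t))\<^sup>2 + (sin (\<phi> t))\<^sup>2) \<longlongrightarrow> a\<^sup>2 + b\<^sup>2) at_top"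
    by (intro tendsto_intros a b)
  then have "((\<lambda>_::real. 1) \<longlongrightarrow> a\<^sup>2 + b\<^sup>2) at_top" by simp
  then have "a\<^sup>2 + b\<^sup>2 = 1" by (simp add: tendsto_const_iff)
  then obtain \<phi>s where "a = cos \<phi>s" "b = sin \<phi>s" by (metis sincos_total_2pi)
  with a b that show thesis by blast
qed

lemma flow_tendsto:
  assumes "((\<lambda>t. cos (\<phi> t)) \<longlongrightarrow> cos \<phi>s) at_top" "((\<lambda>t. sin (\<phi> t)) \<longlongrightarrow> sin \<phi>s) at_top"
    and co: "((\<lambda>t. co t x) \<longlongrightarrow> c) at_top" and "c\<^sup>2 = 1"
  shows "((\<lambda>t. cos (\<Theta> t x)) \<longlongrightarrow> c * cos \<phi>s) at_top" "((\<lambda>t. sin (\<Theta> t x)) \<longlongrightarrow> c * sin \<phi>s) at_top"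
proof -
  note si = si_tendsto_0[OF co \<open>c\<^sup>2 = 1\<close>]
  have "((\<lambda>t. co t x * cos (\<phi> t) - si t x * sin (\<phi> t)) \<longlongrightarrow> c * cos \<phi>s - 0 * sin \<phi>s) at_top"
    by (intro tendsto_intros assms si)
  then show "((\<lambda>t. cos (\<Theta> t x)) \<longlongrightarrow> c * cos \<phi>s) at_top"
    by (simp add: co_def si_def flip: cos_add)
  have "((\<lambda>t. si t x * cos (\<phi> t) + co t x * sin (\<phi> t)) \<longlongrightarrow> 0 * cos \<phi>s + c * sin \<phi>s) at_top"
    by (intro tendsto_intros assms si)
  then show "((\<lambda>t. sin (\<Theta> t x)) \<longlongrightarrow> c * sin \<phi>s) at_top"
    by (simp add: co_def si_def flip: sin_add)
qed

end

section \<open>From convergence of the phase to the weak-* limit\<close>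

theorem theorem3p4:
  fixes \<rho>0 :: "real measure"
    and \<Theta> :: "real \<Rightarrow> real \<Rightarrow> real"
    and R \<phi> :: "real \<Rightarrow> real"
  assumes "prob_space \<rho>0"
    and "sets \<rho>0 = sets borel"
    and "emeasure \<rho>0 {0..<2*pi} = 1"
    and "kuramoto_solution \<rho>0 \<Theta> R \<phi>"
    and "\<not> kuramoto_stationary \<rho>0 \<Theta>"
  shows "\<exists>c1 c2 \<phi>s. c1 > c2 \<and> c2 \<ge> 0 \<and> c1 + c2 = 1 \<and>
           weak_star_conv_type \<rho>0 \<Theta> c1 c2 \<phi>s \<and>
           ((\<forall>x. emeasure \<rho>0 {x} = 0) \<longrightarrow>
              c1 = 1 \<and> ((\<lambda>t. cis (\<phi> t)) \<longlongrightarrow> cis \<phi>s) at_top)"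
proof -
  interpret prob_space \<rho>0 by fact
  note sets = \<open>sets \<rho>0 = sets borel\<close>
  have init: "\<Theta> 0 x = x" for x using assms(4) by (auto simp: kuramoto_solution_def)
  interpret kuramoto_flow \<rho>0 \<Theta> R \<phi>
    using assms(4) measurable_cong_sets[OF sets refl, of borel]
    by unfold_locales (auto simp: kuramoto_solution_def)
  have "R 0 \<noteq> 0"
  proof
    assume "R 0 = 0"
    then have "\<Theta> t x = x" if "0 \<le> t" for t x using flow_constant_of_R_zero[OF _ that] init by simp
    then show False using assms(5) by (simp add: kuramoto_stationary_def)
  qed
  then interpret kuramoto_coherent \<rho>0 \<Theta> R \<phi>
    using R_nonneg[of 0] by unfold_locales simp
  \<comment> \<open>Restriction to the fundamental domain, which carries all the mass, turns
    uniqueness modulo 2 pi into \<open>P\<close> having at most one element.\<close>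
  define P where "P = {p \<in> {0..<2*pi}. ((\<lambda>t. co t p) \<longlongrightarrow> -1) at_top}"
  have P_unique: "x = y" if "x \<in> P" "y \<in> P" for x y
  proof -
    have "cos (x - y) = 1" using antipodal_unique[of x y] that by (simp add: P_def init)
    then obtain n :: int where n: "x - y = n * 2 * pi" by (auto simp: cos_one_2pi_int)
    have "\<bar>x - y\<bar> < 2 * pi" using that by (auto simp: P_def)
    then have "\<bar>real_of_int n\<bar> * (2 * pi) < 1 * (2 * pi)" unfolding n by (simp add: abs_mult)
    then have "\<bar>real_of_int n\<bar> < 1" by (rule mult_right_less_imp_less) simp
    then have "n = 0" by linarith
    then show ?thesis using n by simp
  qed
  have P_cases: "P = {} \<or> (\<exists>p. P = {p} \<and> ((\<lambda>t. co t p) \<longlongrightarrow> -1) at_top)"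
  proof (cases "P = {}")
    case False
    then obtain p where "p \<in> P" by blast
    then have "P = {p}" using P_unique by blast
    then show ?thesis using \<open>p \<in> P\<close> by (auto simp: P_def)
  qed simp
  then have P: "P \<in> sets \<rho>0" by (auto simp: sets)
  have "AE x in \<rho>0. x \<in> {0..<2*pi}"
    using assms(3) by (intro AE_prob_1) (simp add: measure_def)
  then have out: "AE x in \<rho>0. x \<notin> P \<longrightarrow> ((\<lambda>t. co t x) \<longlongrightarrow> 1) at_top"
    by eventually_elim (use co_dichotomy in \<open>auto simp: P_def\<close>)
  have ins: "((\<lambda>t. co t x) \<longlongrightarrow> -1) at_top" if "x \<in> P" for x using that by (simp add: P_def)
  obtain \<phi>s where \<phi>s: "((\<lambda>t. cos (\<phi> t)) \<longlongrightarrow> cos \<phi>s) at_top" "((\<lambda>t. sin (\<phi> t)) \<longlongrightarrow> sin \<phi>s) at_top"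
    by (rule phase_convergent[OF P out P_cases])
  define m where "m = prob P"
  have "eventually (\<lambda>t. R 0 \<le> R t) at_top"
    using eventually_ge_at_top[of 0] by eventually_elim (rule R_ge)
  \<comment> \<open>\<open>R\<close> never falls below \<open>R 0\<close> and tends to
    \<open>1 - 2 * m\<close>; positivity of \<open>R 0\<close> then yields the strict inequality
    between the two masses.\<close>
  then have "R 0 \<le> 1 - 2 * m"
    unfolding m_def by (intro tendsto_lowerbound[OF R_tendsto[OF P out ins]]) auto
  then have m: "0 \<le> m" "m < 1 - m" using R0_pos by (auto simp: m_def)
  have weak: "weak_star_conv_type \<rho>0 \<Theta> (1 - m) m \<phi>s"
    unfolding weak_star_conv_type_def
  proof (intro allI impI)
    fix f assume f: "circ_cont f"
    obtain B where B: "\<And>x. \<bar>f x\<bar> \<le> B" using circ_cont_bounded[OF f] by blast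
    have f_meas: "f \<in> borel_measurable borel"
      using f by (intro borel_measurable_continuous_onI) (simp add: circ_cont_def)
    have "((\<lambda>t. \<integral>x. f (\<Theta> t x) \<partial>\<rho>0) \<longlongrightarrow>
        (\<integral>x. f \<phi>s + indicator P x * (f (\<phi>s + pi) - f \<phi>s) \<partial>\<rho>0)) at_top"
    proof (rule tendsto_integral_bounded_at_top[OF _ B])
      show "(\<lambda>x. f (\<Theta> t x)) \<in> borel_measurable \<rho>0" if "0 \<le> t" for t
        using measurable_compose[OF flow_measurable[OF that] f_meas] .
      show "AE x in \<rho>0. ((\<lambda>t. f (\<Theta> t x)) \<longlongrightarrow> f \<phi>s + indicator P x * (f (\<phi>s + pi) - f \<phi>s)) at_top"
        using out
      proof eventually_elim
        case (elim x)
        show ?case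
        proof (cases "x \<in> P")
          case True
          have "((\<lambda>t. f (\<Theta> t x)) \<longlongrightarrow> f (\<phi>s + pi)) at_top"
            using flow_tendsto[OF \<phi>s ins[OF True]] by (intro circ_cont_tendsto[OF f]) simp_all
          then show ?thesis using True by simp
        next
          case False
          then have "((\<lambda>t. f (\<Theta> t x)) \<longlongrightarrow> f \<phi>s) at_top"
            using flow_tendsto[OF \<phi>s, of x 1] elim by (intro circ_cont_tendsto[OF f]) simp_all
          then show ?thesis using False by simp
        qed
      qed
    qed (use P in measurable)
    moreover have "(\<integral>x. f \<phi>s + indicator P x * (f (\<phi>s + pi) - f \<phi>s) \<partial>\<rho>0)
        = (1 - m) * f \<phi>s + m * f (\<phi>s + pi)"
      using P by (simp add: prob_space m_def less_top[symmetric] algebra_simps)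
    ultimately show "((\<lambda>t. \<integral>x. f (\<Theta> t x) \<partial>\<rho>0) \<longlongrightarrow> (1 - m) * f \<phi>s + m * f (\<phi>s + pi)) at_top"
      by simp
  qed
  have "((\<lambda>t. Complex (cos (\<phi> t)) (sin (\<phi> t))) \<longlongrightarrow> Complex (cos \<phi>s) (sin \<phi>s)) at_top"
    by (intro tendsto_Complex \<phi>s)
  then have phase: "((\<lambda>t. cis (\<phi> t)) \<longlongrightarrow> cis \<phi>s) at_top" by (simp flip: cis.ctr)
  have "m = 0" if "\<forall>x. emeasure \<rho>0 {x} = 0"
    using P_cases that by (auto simp: m_def measure_def)
  then show ?thesis using m weak phase by (intro exI[of _ "1 - m"] exI[of _ m] exI[of _ \<phi>s]) auto
qed

end
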